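(* Let $n\geqslant 3$, $1\leqslant k\leqslant n-2$ and $1\leqslant j\leqslant n-k-1$ be integers. Then $$\sup\left\{\frac{W_j(K)}{|K|^{\frac{k}{n}}\,\max_{H\in G_{n,n-k}}W_j(K\cap H)}: K\text{ is a convex body in }\mathbb{R}^n\right\}=+\infty .$$ In fact, one also has $$\sup\left\{\frac{W_j(K)}{|K|^{\frac{k}{n}}\,\max_{H\in G_{n,n-k}}W_j(P_H(K))}: K\text{ is a convex body in }\mathbb{R}^n\right\}=+\infty .$$
   Context: A convex body in $\mathbb{R}^n$ is a compact convex set with non-empty interior; $|\cdot|$ is volume. $G_{n,s}$ is the Grassmannian of $s$-dimensional linear subspaces of $\mathbb{R}^n$ and $P_H$ is the orthogonal projection onto $H$. For a compact convex set $A$ in an $m$-dimensional Euclidean space $E$ with unit ball $B_E$, the quermassintegrals $W_0(A),\dots,W_m(A)$ (relative to $E$) are defined by $|A+tB_E|=\sum_{j=0}^m\binom{m}{j}W_j(A)\,t^j$ for $t\geqslant0$, where $|\cdot|$ is $m$-dimensional volume (and $W_j(\emptyset)=0$). $W_j(K)$ is computed in $\mathbb{R}^n$, while $W_j(K\cap H)$ and $W_j(P_H(K))$ are computed in the $(n-k)$-dimensional space $H$. *)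

theory Defs
  imports "HOL-Analysis.Analysis"
begin

definition convex_body :: "'a::euclidean_space set \<Rightarrow> bool" where
  "convex_body K \<longleftrightarrow> compact K \<and> convex K \<and> interior K \<noteq> {}"

definition grassmannian :: "nat \<Rightarrow> 'a::euclidean_space set set" where
  "grassmannian s = {H. subspace H \<and> dim H = s}"

definition orth_proj :: "'a::euclidean_space set \<Rightarrow> 'a \<Rightarrow> 'a" where
  "orth_proj H x = (THE y. y \<in> H \<and> (\<forall>z\<in>H. orthogonal (x - y) z))"

definition orthonormal_basis :: "'a::euclidean_space set \<Rightarrow> 'a set \<Rightarrow> bool" where
  "orthonormal_basis H B \<longleftrightarrow>
     pairwise orthogonal B \<and> (\<forall>b\<in>B. norm b = 1) \<and> span B = H"

lemma orthonormal_basis_exists: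
  assumes "subspace H"
  shows "\<exists>B. orthonormal_basis H B"
  using orthonormal_basis_subspace[OF assms] unfolding orthonormal_basis_def by metis

(* Lebesgue measure of dimension dim H on the subspace H, as a Borel measure on the ambient
   space that is concentrated on H.  It is built exactly as lborel is, with an orthonormal
   basis of H in place of Basis; rotation invariance of Lebesgue measure makes the result
   independent of the basis chosen, and subspace_lborel UNIV agrees with lborel. *)
definition subspace_lborel :: "'a::euclidean_space set \<Rightarrow> 'a measure" where
  "subspace_lborel H =
     (let B = (SOME B. orthonormal_basis H B)
      in distr (\<Pi>\<^sub>M b\<in>B. (lborel :: real measure)) borel (\<lambda>f. \<Sum>b\<in>B. f b *\<^sub>R b))"

definition parallel_body :: "'a::euclidean_space set \<Rightarrow> 'a set \<Rightarrow> real \<Rightarrow> 'a set" where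
  "parallel_body E A t = {a + t *\<^sub>R u | a u. a \<in> A \<and> u \<in> E \<and> norm u \<le> 1}"

definition steiner_coeffs :: "'a::euclidean_space set \<Rightarrow> 'a set \<Rightarrow> (nat \<Rightarrow> real) \<Rightarrow> bool" where
  "steiner_coeffs E A w \<longleftrightarrow>
     (\<forall>t\<ge>0. measure (subspace_lborel E) (parallel_body E A t) =
        (\<Sum>j\<le>dim E. real (dim E choose j) * w j * t ^ j))"

(* The condition for i > dim E only makes the sequence unique; such indices have no meaning. *)
definition quermassintegral :: "'a::euclidean_space set \<Rightarrow> nat \<Rightarrow> 'a set \<Rightarrow> real" where
  "quermassintegral E j A =
     (THE w. steiner_coeffs E A w \<and> (\<forall>i>dim E. w i = 0)) j"

lemma quermassintegral_eqI:
  assumes w: "steiner_coeffs E A w" and j: "j \<le> dim E"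
  shows "quermassintegral E j A = w j"
proof -
  define v where "v i = (if i \<le> dim E then w i else 0)" for i
  have "(\<Sum>i\<le>dim E. real (dim E choose i) * w i * t ^ i) =
        (\<Sum>i\<le>dim E. real (dim E choose i) * v i * t ^ i)" for t
    by (intro sum.cong) (simp_all add: v_def)
  then have v: "steiner_coeffs E A v"
    using w by (simp only: steiner_coeffs_def)
  have v0: "\<forall>i>dim E. v i = 0"
    by (simp add: v_def)
  have uniq: "u = v" if u: "steiner_coeffs E A u" and u0: "\<forall>i>dim E. u i = 0" for u
  proof -
    define c where "c i = real (dim E choose i) * u i - real (dim E choose i) * v i" for i
    have "(\<Sum>i\<le>dim E. c i * t ^ i) = 0" if "t \<ge> 0" for t
    proof -
      have "(\<Sum>i\<le>dim E. real (dim E choose i) * u i * t ^ i) =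
            (\<Sum>i\<le>dim E. real (dim E choose i) * v i * t ^ i)"
        using u v that unfolding steiner_coeffs_def by metis
      then show ?thesis
        by (simp only: c_def left_diff_distrib sum_subtractf)
    qed
    then have "{0..} \<subseteq> {t. (\<Sum>i\<le>dim E. c i * t ^ i) = 0}"
      by auto
    then have "\<not> finite {t. (\<Sum>i\<le>dim E. c i * t ^ i) = 0}"
      using infinite_Ici[of "0::real"] finite_subset by blast
    then have c0: "c i = 0" if "i \<le> dim E" for i
      using Transcendental.polyfun_finite_roots[of c "dim E"] that by blast
    show ?thesis
    proof
      fix i
      show "u i = v i"
      proof (cases "i \<le> dim E")
        case True
        then have "real (dim E choose i) \<noteq> 0"
          by simp
        then show ?thesis
          using c0[OF True] unfolding c_def by simp
      next
        case False
        then show ?thesis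
          using u0 v0 by simp
      qed
    qed
  qed
  have "(THE w. steiner_coeffs E A w \<and> (\<forall>i>dim E. w i = 0)) = v"
    by (rule the_equality) (use v v0 uniq in blast)+
  then show ?thesis
    using j by (simp add: quermassintegral_def v_def)
qed

end

theory Submission
  imports Defs
begin

text \<open>
  The quotients are unbounded because of flat boxes. Let $K$ be a box in $\mathbb{R}^n$ with one side
  of length $\varepsilon$ and all others of length $1$. As $\varepsilon \to 0$ the volume tends to
  $0$, and so does $|K|^{k/n}$ since $k \geq 1$. On the other hand $W_j(K)$ is up to a constant the
  $(n-j)$-dimensional intrinsic volume, and because $j \geq 1$ the box still has
  faces of dimension $n - j$ and volume $1$: $W_j(K)$ stays above a positive constant. Every section
  and every projection of $K$ lies in a fixed ball, so its quermassintegrals stay below a constant.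

  What needs work is that quermassintegrals are defined through the Steiner polynomial, whose existence
  has to be established for every section and every projection of $K$. All of these are polytopes, and
  for a polytope $A$ in a subspace $H$ the Steiner formula is elementary
  (\<open>steiner_coeffs_polyhedron_in\<close>). Split the parallel body according to the relatively open face
  that contains the nearest point in $A$. The part over a face consists of the points $p + v$ with $p$
  in the face and $v$ an outer normal of length at most $t$. All points of the face have the same outer
  normals, and they are orthogonal to the face, so the part at distance $t$ is the
  part at distance $1$ dilated by $t$ in the directions orthogonal to the face
  (\<open>layer_eq_dilate\<close>). Its measure is therefore a constant times $t^e$, where $e$ is the codimension
  of the face (\<open>emeasure_dilate_normal\<close>).

  The formula also yields the estimates. Its coefficients are non-negative, so each is at most the
  measure of the parallel body at distance $1$ (\<open>quermassintegral_polytope_le\<close>); and each is at least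
  the contribution of any single face, which for a box is easily bounded from below
  (\<open>quermassintegral_coordinate_box_ge\<close>).

  The measure on $H$ is defined by an arbitrary orthonormal basis of $H$, whereas the dilations above
  are diagonal only in a basis adapted to the face. The comparison rests on rotation invariance of
  Lebesgue measure (\<open>lborel_distr_orthogonal\<close>) together with a description of the measure on $H$ as
  the ambient volume of cylinders (\<open>emeasure_subspace_lborel\<close>).
\<close>

section \<open>Rotation invariance of Lebesgue measure\<close>

lemma nn_integral_lborel_add:
  fixes c :: "'a::euclidean_space"
  assumes "f \<in> borel_measurable borel"
  shows "(\<integral>\<^sup>+x. f (c + x) \<partial>lborel) = (\<integral>\<^sup>+x. f x \<partial>lborel)"
proof -
  have "(\<integral>\<^sup>+x. f x \<partial>lborel) = (\<integral>\<^sup>+x. f x \<partial>distr lborel borel ((+) c))"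
    by (simp add: lborel_distr_plus)
  also have "\<dots> = (\<integral>\<^sup>+x. f (c + x) \<partial>lborel)"
    using assms by (subst nn_integral_distr) auto
  finally show ?thesis by simp
qed

text \<open>
  This is uniqueness of a translation invariant measure. Write $\mu$ for the image of Lebesgue
  measure $\lambda$ under $T$. It is translation invariant because $T$ is onto and additive, so
  Tonelli and the two shifts $y \mapsto y - Tx$ and $Tx \mapsto Tx + y$ turn
  $\mu(A)\lambda(B)$ into $\lambda(A)\mu(-B)$. For the unit ball $B$ one has
  $-B = B = T^{-1}B$, hence $\mu(-B) = \lambda(B)$, and this positive finite factor cancels.
\<close>

lemma lborel_distr_orthogonal:
  fixes T :: "'a::euclidean_space \<Rightarrow> 'a"
  assumes T: "orthogonal_transformation T"
  shows "distr lborel borel T = lborel"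
proof (rule measure_eqI)
  have lin: "linear T" using T by (rule orthogonal_transformation_linear)
  have Tm[measurable]: "T \<in> borel_measurable borel"
    using lin by (intro borel_measurable_continuous_onI linear_continuous_on) (simp add: linear_conv_bounded_linear)
  fix A assume "A \<in> sets (distr lborel borel T)"
  then have A[measurable]: "A \<in> sets borel" by simp
  define B where "B = ball (0::'a) 1"
  have B[measurable]: "B \<in> sets borel" by (simp add: B_def)
  let ?g = "\<lambda>x y. indicator A x * indicator B y :: ennreal"
  have inv: "\<exists>u. T u = y" for y
    using orthogonal_transformation_surj[OF T] by (metis surjD)
  have shift: "(\<integral>\<^sup>+x. ?g (T x) (y - T x) \<partial>lborel) = (\<integral>\<^sup>+x. ?g (T x + y) (- T x) \<partial>lborel)" for y
  proof -
    obtain u where u: "T u = y" using inv by blast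
    have "(\<integral>\<^sup>+x. ?g (T x) (y - T x) \<partial>lborel) = (\<integral>\<^sup>+x. ?g (T (u + x)) (y - T (u + x)) \<partial>lborel)"
      by (rule nn_integral_lborel_add[symmetric]) measurable
    also have "\<dots> = (\<integral>\<^sup>+x. ?g (T x + y) (- T x) \<partial>lborel)"
      by (simp add: linear_add[OF lin] u add.commute)
    finally show ?thesis .
  qed
  have "emeasure (distr lborel borel T) A * emeasure lborel B = (\<integral>\<^sup>+x. \<integral>\<^sup>+y. ?g (T x) y \<partial>lborel \<partial>lborel)"
  proof -
    have "emeasure (distr lborel borel T) A = (\<integral>\<^sup>+x. indicator A (T x) \<partial>lborel)"
      using A by (subst nn_integral_indicator[symmetric]) (simp_all add: nn_integral_distr del: nn_integral_indicator)
    then show ?thesis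
      by (simp add: nn_integral_cmult nn_integral_multc)
  qed
  also have "\<dots> = (\<integral>\<^sup>+x. \<integral>\<^sup>+y. ?g (T x) (y - T x) \<partial>lborel \<partial>lborel)"
  proof (rule nn_integral_cong)
    fix x
    have "(\<integral>\<^sup>+y. ?g (T x) (- T x + y) \<partial>lborel) = (\<integral>\<^sup>+y. ?g (T x) y \<partial>lborel)"
      by (rule nn_integral_lborel_add) measurable
    then show "(\<integral>\<^sup>+y. ?g (T x) y \<partial>lborel) = (\<integral>\<^sup>+y. ?g (T x) (y - T x) \<partial>lborel)"
      by simp
  qed
  also have "\<dots> = (\<integral>\<^sup>+y. \<integral>\<^sup>+x. ?g (T x) (y - T x) \<partial>lborel \<partial>lborel)"
    by (rule lborel_pair.Fubini') measurable
  also have "\<dots> = (\<integral>\<^sup>+y. \<integral>\<^sup>+x. ?g (T x + y) (- T x) \<partial>lborel \<partial>lborel)"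
    by (simp only: shift)
  also have "\<dots> = (\<integral>\<^sup>+x. \<integral>\<^sup>+y. ?g (T x + y) (- T x) \<partial>lborel \<partial>lborel)"
    by (rule lborel_pair.Fubini'[symmetric]) measurable
  also have "\<dots> = (\<integral>\<^sup>+x. emeasure lborel A * indicator B x \<partial>lborel)"
  proof (rule nn_integral_cong)
    fix x
    have "indicator B (- T x) = (indicator B x :: ennreal)"
      by (simp add: B_def indicator_def orthogonal_transformation_norm[OF T])
    moreover have "(\<integral>\<^sup>+y. indicator A (T x + y) \<partial>lborel) = emeasure lborel A"
      by (subst nn_integral_lborel_add) auto
    ultimately show "(\<integral>\<^sup>+y. ?g (T x + y) (- T x) \<partial>lborel) = emeasure lborel A * indicator B x"
      by (simp add: nn_integral_multc)
  qed
  also have "\<dots> = emeasure lborel A * emeasure lborel B"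
    by (simp add: nn_integral_cmult)
  finally have "emeasure (distr lborel borel T) A * emeasure lborel B = emeasure lborel A * emeasure lborel B" .
  moreover have "emeasure lborel B \<noteq> 0" "emeasure lborel B \<noteq> \<infinity>"
    using emeasure_lborel_ball_finite[of "0::'a" 1] content_ball_pos[of 1 "0::'a"]
    by (auto simp: B_def measure_def)
  ultimately show "emeasure (distr lborel borel T) A = emeasure lborel A"
    by (simp add: mult.commute[of _ "emeasure lborel B"] ennreal_mult_cancel_left)
qed simp

lemma orthonormal_basisD:
  assumes "orthonormal_basis H B"
  shows "finite B" "b \<in> B \<Longrightarrow> c \<in> B \<Longrightarrow> b \<bullet> c = (if b = c then 1 else 0)"
    "span B = H" "card B = dim H" "b \<in> B \<Longrightarrow> b \<in> H"
proof -
  have p: "pairwise orthogonal B" and n: "\<And>b. b \<in> B \<Longrightarrow> norm b = 1" and s: "span B = H"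
    using assms by (auto simp: orthonormal_basis_def)
  have "0 \<notin> B" using n by force
  then have ind: "independent B" using p by (rule pairwise_orthogonal_independent[rotated])
  then show "finite B" by (rule independent_imp_finite)
  show "b \<in> B \<Longrightarrow> c \<in> B \<Longrightarrow> b \<bullet> c = (if b = c then 1 else 0)"
    using p n by (auto simp: pairwise_def orthogonal_def norm_eq_1)
  show "span B = H" by fact
  show "card B = dim H" using ind s by (metis dim_span_eq_card_independent dim_span)
  show "b \<in> B \<Longrightarrow> b \<in> H" using s span_base by blast
qed

lemma inner_sum_orthonormal:
  assumes "orthonormal_basis H B" "b \<in> B"
  shows "(\<Sum>c\<in>B. f c *\<^sub>R c) \<bullet> b = f b"
proof -
  have "(\<Sum>c\<in>B. f c *\<^sub>R c) \<bullet> b = (\<Sum>c\<in>B. f c * (c \<bullet> b))"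
    by (simp add: inner_sum_left)
  also have "\<dots> = (\<Sum>c\<in>B. if c = b then f c else 0)"
    using assms orthonormal_basisD(2)[OF assms(1)] by (intro sum.cong) auto
  also have "\<dots> = f b" using assms orthonormal_basisD(1)[OF assms(1)] by simp
  finally show ?thesis .
qed

lemma orthonormal_basis_rotation:
  fixes B :: "'a::euclidean_space set"
  assumes B: "orthonormal_basis UNIV B"
  obtains T :: "'a \<Rightarrow> 'a" where "orthogonal_transformation T" "bij_betw T Basis B"
proof -
  note D = orthonormal_basisD[OF B]
  have "card B = card (Basis :: 'a set)" using D(4) by simp
  then obtain \<phi> where \<phi>: "bij_betw \<phi> (Basis :: 'a set) B"
    using D(1) by (metis finite_Basis finite_same_card_bij)
  define T where "T x = (\<Sum>i\<in>Basis. (x \<bullet> i) *\<^sub>R \<phi> i)" for x :: 'a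
  have "T i = \<phi> i" if "i \<in> Basis" for i
  proof -
    have "T i = (\<Sum>j\<in>Basis. if j = i then \<phi> j else 0)"
      unfolding T_def using that by (intro sum.cong) (auto simp: inner_Basis)
    then show ?thesis using that by simp
  qed
  then have bij: "bij_betw T Basis B" using \<phi> by (simp cong: bij_betw_cong)
  have on: "\<phi> i \<bullet> \<phi> j = (if i = j then 1 else 0)" if "i \<in> Basis" "j \<in> Basis" for i j
    using D(2)[of "\<phi> i" "\<phi> j"] that \<phi> by (auto simp: bij_betw_def inj_on_eq_iff)
  have "T x \<bullet> T y = x \<bullet> y" for x y
  proof -
    have "T x \<bullet> T y = (\<Sum>i\<in>Basis. \<Sum>j\<in>Basis. (x \<bullet> i) * (y \<bullet> j) * (\<phi> i \<bullet> \<phi> j))"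
      by (simp add: T_def inner_sum_left inner_sum_right sum_distrib_left mult_ac)
         (rule sum.swap)
    also have "\<dots> = (\<Sum>i\<in>Basis. \<Sum>j\<in>Basis. if i = j then (x \<bullet> i) * (y \<bullet> j) else 0)"
      by (intro sum.cong) (auto simp: on)
    also have "\<dots> = x \<bullet> y" by (simp add: euclidean_inner[of x y])
    finally show ?thesis .
  qed
  moreover have "linear T"
    unfolding T_def by (intro linear_compose_sum ballI) (auto intro!: linearI simp: inner_add_left scaleR_add_left)
  ultimately have "orthogonal_transformation T"
    by (simp add: orthogonal_transformation_def)
  then show thesis using bij that by blast
qed

lemma emeasure_lborel_Basis_rectangle:
  fixes A :: "'a::euclidean_space \<Rightarrow> real set"
  assumes A: "\<And>i. i \<in> Basis \<Longrightarrow> A i \<in> sets borel"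
  shows "emeasure lborel {x::'a. \<forall>i\<in>Basis. x \<bullet> i \<in> A i} = (\<Prod>i\<in>Basis. emeasure lborel (A i))"
proof -
  interpret product_sigma_finite "\<lambda>_. lborel :: real measure" ..
  note A[measurable]
  have "emeasure lborel {x::'a. \<forall>i\<in>Basis. x \<bullet> i \<in> A i} =
    emeasure (\<Pi>\<^sub>M b\<in>(Basis::'a set). lborel) ((\<lambda>f. \<Sum>b\<in>Basis. f b *\<^sub>R b) -` {x::'a. \<forall>i\<in>Basis. x \<bullet> i \<in> A i} \<inter> space (\<Pi>\<^sub>M b\<in>(Basis::'a set). lborel))"
    by (subst lborel_eq) (intro emeasure_distr; measurable)
  also have "(\<lambda>f. \<Sum>b\<in>Basis. f b *\<^sub>R b) -` {x::'a. \<forall>i\<in>Basis. x \<bullet> i \<in> A i} \<inter> space (\<Pi>\<^sub>M b\<in>(Basis::'a set). lborel) = Pi\<^sub>E Basis A"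
    by (auto simp: space_PiM PiE_iff)
  also have "emeasure (\<Pi>\<^sub>M b\<in>(Basis::'a set). lborel) (Pi\<^sub>E Basis A) = (\<Prod>i\<in>Basis. emeasure lborel (A i))"
    using A by (intro emeasure_PiM) auto
  finally show ?thesis .
qed

text \<open>
  Lebesgue measure is a product measure in the coordinates of every orthonormal basis. This is the
  form in which rotation invariance is used below.
\<close>

lemma emeasure_lborel_rectangle:
  fixes B :: "'a::euclidean_space set"
  assumes B: "orthonormal_basis UNIV B" and A: "\<And>b. b \<in> B \<Longrightarrow> A b \<in> sets borel"
  shows "emeasure lborel {x. \<forall>b\<in>B. x \<bullet> b \<in> A b} = (\<Prod>b\<in>B. emeasure lborel (A b))"
proof -
  obtain T :: "'a \<Rightarrow> 'a" where T: "orthogonal_transformation T" and bij: "bij_betw T Basis B"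
    using orthonormal_basis_rotation[OF B] .
  note A[measurable]
  have [measurable]: "Measurable.pred borel (\<lambda>x. \<forall>b\<in>B. x \<bullet> b \<in> A b)"
    using orthonormal_basisD(1)[OF B] by measurable
  have Tm[measurable]: "T \<in> borel_measurable borel"
    using orthogonal_transformation_linear[OF T]
    by (intro borel_measurable_continuous_onI linear_continuous_on) (simp add: linear_conv_bounded_linear)
  have "emeasure lborel {x. \<forall>b\<in>B. x \<bullet> b \<in> A b} = emeasure (distr lborel borel T) {x. \<forall>b\<in>B. x \<bullet> b \<in> A b}"
    by (simp add: lborel_distr_orthogonal[OF T])
  also have "\<dots> = emeasure lborel {x. \<forall>b\<in>B. T x \<bullet> b \<in> A b}"
    by (subst emeasure_distr) (auto simp: vimage_def)
  also have "{x. \<forall>b\<in>B. T x \<bullet> b \<in> A b} = {x. \<forall>i\<in>Basis. x \<bullet> i \<in> A (T i)}"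
    using T bij by (auto simp: bij_betw_def orthogonal_transformation_def)
  also have "emeasure lborel \<dots> = (\<Prod>i\<in>Basis. emeasure lborel (A (T i)))"
    by (rule emeasure_lborel_Basis_rectangle) (use bij A in \<open>auto simp: bij_betw_def\<close>)
  also have "\<dots> = (\<Prod>b\<in>B. emeasure lborel (A b))"
    using prod.reindex_bij_betw[OF bij] .
  finally show ?thesis .
qed

section \<open>Lebesgue measure on a subspace, seen from the ambient space\<close>

definition complement_in :: "'a::euclidean_space set \<Rightarrow> 'a set \<Rightarrow> 'a set" where
  "complement_in E D = {y \<in> E. \<forall>x\<in>D. orthogonal x y}"

lemma subspace_complement_in: "subspace E \<Longrightarrow> subspace (complement_in E D)"
  by (auto simp: complement_in_def subspace_def orthogonal_clauses)

lemma orthonormal_basis_extend: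
  assumes E: "subspace E" and DE: "D \<subseteq> E"
    and B: "orthonormal_basis D B" and C: "orthonormal_basis (complement_in E D) C"
  shows "orthonormal_basis E (B \<union> C)" "B \<inter> C = {}"
proof -
  have BC: "orthogonal b c" if "b \<in> B" "c \<in> C" for b c
    using orthonormal_basisD(5)[OF B that(1)] orthonormal_basisD(5)[OF C that(2)]
    by (auto simp: complement_in_def)
  have norms: "norm b = 1" if "b \<in> B \<union> C" for b
    using that B C by (auto simp: orthonormal_basis_def)
  show "B \<inter> C = {}"
    using BC norms by (fastforce simp: orthogonal_self)
  have "pairwise orthogonal (B \<union> C)"
    using B C BC BC[THEN orthogonal_commute[THEN iffD1]] by (auto simp: orthonormal_basis_def pairwise_def)
  moreover have "span (B \<union> C) = E"
  proof
    have "B \<union> C \<subseteq> E"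
      using orthonormal_basisD(5)[OF B] orthonormal_basisD(5)[OF C] DE by (auto simp: complement_in_def)
    then show "span (B \<union> C) \<subseteq> E" using E by (rule span_minimal)
    show "E \<subseteq> span (B \<union> C)"
    proof
      fix x assume x: "x \<in> E"
      obtain y z where y: "y \<in> span D" and z: "\<And>w. w \<in> span D \<Longrightarrow> orthogonal z w" and xyz: "x = y + z"
        using orthogonal_subspace_decomp_exists[of D x] by metis
      have D: "span D = D" using B by (auto simp: orthonormal_basis_def)
      have "z \<in> complement_in E D"
        using y z D DE x xyz subspace_diff[OF E, of x y] by (auto simp: complement_in_def orthogonal_commute)
      then show "x \<in> span (B \<union> C)"
        using y D B C unfolding xyz orthonormal_basis_def
        by (metis UnCI span_add span_mono subsetD sup_ge1 sup_ge2)
    qed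
  qed
  ultimately show "orthonormal_basis E (B \<union> C)"
    using norms by (auto simp: orthonormal_basis_def)
qed

lemma orth_proj_eq_sum:
  assumes B: "orthonormal_basis H B"
  shows "orth_proj H x = (\<Sum>b\<in>B. (x \<bullet> b) *\<^sub>R b)"
  unfolding orth_proj_def
proof (rule the_equality)
  let ?y = "\<Sum>b\<in>B. (x \<bullet> b) *\<^sub>R b"
  have s: "subspace H" using B by (auto simp: orthonormal_basis_def)
  have "?y \<in> H"
    using orthonormal_basisD(5)[OF B] s by (intro subspace_sum subspace_scale) auto
  moreover have "orthogonal (x - ?y) z" if "z \<in> H" for z
  proof (rule orthogonal_to_span)
    show "z \<in> span B" using that orthonormal_basisD(3)[OF B] by simp
    show "orthogonal (x - ?y) b" if "b \<in> B" for b
      using inner_sum_orthonormal[OF B that] by (simp add: orthogonal_def inner_diff_left)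
  qed
  ultimately show y: "?y \<in> H \<and> (\<forall>z\<in>H. orthogonal (x - ?y) z)" by blast
  fix y assume y': "y \<in> H \<and> (\<forall>z\<in>H. orthogonal (x - y) z)"
  then have "orthogonal (x - y) (?y - y)" "orthogonal (x - ?y) (?y - y)"
    using y subspace_diff[OF s] by blast+
  then have "orthogonal (?y - y) (?y - y)"
    by (simp add: orthogonal_def inner_diff_left)
  then show "y = ?y" by (simp add: orthogonal_self)
qed

lemma orth_proj_mem: "subspace H \<Longrightarrow> orth_proj H x \<in> H"
  using orthonormal_basis_exists[of H] orth_proj_eq_sum orthonormal_basisD(5)
  by (metis (no_types, lifting) subspace_scale subspace_sum)

lemma orth_proj_self:
  assumes "subspace H" "x \<in> H"
  shows "orth_proj H x = x"
proof -
  obtain B where B: "orthonormal_basis H B" using orthonormal_basis_exists[OF assms(1)] by blast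
  show ?thesis
    unfolding orth_proj_eq_sum[OF B]
    using B assms orthonormal_basisD(1)[OF B]
    by (intro orthonormal_basis_expand) (auto simp: orthonormal_basis_def)
qed

lemma linear_orth_proj: "subspace H \<Longrightarrow> linear (orth_proj H)"
proof -
  assume "subspace H"
  then obtain B where B: "orthonormal_basis H B" using orthonormal_basis_exists by blast
  show ?thesis
    unfolding orth_proj_eq_sum[OF B]
    by (intro linear_compose_sum ballI) (auto intro!: linearI simp: inner_add_left scaleR_add_left)
qed

lemma norm_orth_proj_le: "subspace H \<Longrightarrow> norm (orth_proj H x) \<le> norm x"
proof -
  assume H: "subspace H"
  then obtain B where B: "orthonormal_basis H B" using orthonormal_basis_exists by blast
  have "orthogonal (orth_proj H x) (x - orth_proj H x)"
  proof (rule orthogonal_to_span[THEN orthogonal_commute[THEN iffD1]])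
    show "orth_proj H x \<in> span B" using orth_proj_mem[OF H] orthonormal_basisD(3)[OF B] by simp
    show "orthogonal (x - orth_proj H x) b" if "b \<in> B" for b
      using inner_sum_orthonormal[OF B that] orth_proj_eq_sum[OF B] by (simp add: orthogonal_def inner_diff_left)
  qed
  then have "(norm x)\<^sup>2 = (norm (orth_proj H x))\<^sup>2 + (norm (x - orth_proj H x))\<^sup>2"
    using norm_add_Pythagorean by fastforce
  then have "(norm (orth_proj H x))\<^sup>2 \<le> (norm x)\<^sup>2" by simp
  then show ?thesis by (rule power2_le_imp_le) simp
qed

lemma borel_measurable_orth_proj[measurable]: "subspace H \<Longrightarrow> orth_proj H \<in> borel_measurable borel"
  by (intro borel_measurable_continuous_onI linear_continuous_on)
     (simp add: linear_orth_proj linear_conv_bounded_linear[symmetric])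

text \<open>
  The product of a set $S \subseteq H$ with a unit cube in the orthogonal complement of $H$,
  the edges of the cube being given by an orthonormal basis $C$ of that complement.
\<close>

definition unit_cylinder :: "'a::euclidean_space set \<Rightarrow> 'a set \<Rightarrow> 'a set \<Rightarrow> 'a set" where
  "unit_cylinder H C S = {x. orth_proj H x \<in> S \<and> (\<forall>c\<in>C. x \<bullet> c \<in> {0..1})}"

lemma borel_unit_cylinder[measurable]:
  assumes [measurable]: "S \<in> sets borel" and [simp]: "subspace H" "finite C"
  shows "unit_cylinder H C S \<in> sets borel"
  unfolding unit_cylinder_def by measurable

text \<open>
  The cube factor of the cylinder has volume $1$, so the $(\dim H)$-dimensional measure of $S$ is
  the ambient volume of the cylinder over $S$. This removes the arbitrary choice of a basis in the
  definition of the measure on $H$: the other orthonormal bases that occur later (adapted to a face,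
  or to the coordinate axes) only have to be compared inside the ambient space, where rotation
  invariance applies.
\<close>

lemma emeasure_subspace_lborel:
  fixes H :: "'a::euclidean_space set"
  assumes H: "subspace H" and C: "orthonormal_basis (complement_in UNIV H) C"
    and S[measurable]: "S \<in> sets borel"
  shows "emeasure (subspace_lborel H) S = emeasure lborel (unit_cylinder H C S)"
proof -
  define B where "B = (SOME B. orthonormal_basis H B)"
  have B: "orthonormal_basis H B"
    unfolding B_def using orthonormal_basis_exists[OF H] by (rule someI_ex)
  have BC: "orthonormal_basis UNIV (B \<union> C)" "B \<inter> C = {}"
    using orthonormal_basis_extend[OF subspace_UNIV _ B C] by auto
  have fin[simp]: "finite B" "finite C"
    using orthonormal_basisD(1) B C by auto
  interpret product_sigma_finite "\<lambda>_. lborel :: real measure" ..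
  define Q where "Q = {x::'a. \<forall>c\<in>C. x \<bullet> c \<in> {0..1}}"
  have Q[measurable]: "Q \<in> sets borel" unfolding Q_def by measurable
  define r where "r x = (\<lambda>b\<in>B. x \<bullet> b)" for x :: 'a
  have r[measurable]: "r \<in> borel \<rightarrow>\<^sub>M (\<Pi>\<^sub>M b\<in>B. lborel)"
    unfolding r_def by measurable
  have dens: "emeasure (density lborel (indicator Q)) X = emeasure lborel (Q \<inter> X)" if "X \<in> sets borel" for X
    using that by (simp add: emeasure_density indicator_inter_arith[symmetric])
  \<comment> \<open>Lebesgue measure on the slab $Q$ over $H$ projects to the product measure on $B$.\<close>
  have "distr (density lborel (indicator Q)) (\<Pi>\<^sub>M b\<in>B. lborel) r = (\<Pi>\<^sub>M b\<in>B. lborel)"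
  proof (rule PiM_eqI)
    fix A :: "'a \<Rightarrow> real set" assume A: "\<And>b. b \<in> B \<Longrightarrow> A b \<in> sets lborel"
    define A' where "A' b = (if b \<in> B then A b else {0..1})" for b
    have A'B: "A' b = A b" if "b \<in> B" for b using that by (simp add: A'_def)
    have A'C: "A' b = {0..1}" if "b \<in> C" for b using that BC(2) by (auto simp: A'_def)
    have PA: "Pi\<^sub>E B A \<in> sets (\<Pi>\<^sub>M b\<in>B. lborel)" using A by (intro sets_PiM_I_finite) auto
    have "emeasure (distr (density lborel (indicator Q)) (\<Pi>\<^sub>M b\<in>B. lborel) r) (Pi\<^sub>E B A) =
          emeasure (density lborel (indicator Q)) (r -` Pi\<^sub>E B A)"
      using PA by (subst emeasure_distr) (auto intro: r[THEN measurable_sets])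
    also have "\<dots> = emeasure lborel (Q \<inter> (r -` Pi\<^sub>E B A))"
      using measurable_sets[OF r PA] by (intro dens) simp
    also have "Q \<inter> (r -` Pi\<^sub>E B A) = {x. \<forall>b\<in>B \<union> C. x \<bullet> b \<in> A' b}"
      by (auto simp: Q_def r_def A'B A'C PiE_iff ball_Un)
    also have "emeasure lborel \<dots> = (\<Prod>b\<in>B \<union> C. emeasure lborel (A' b))"
      using A by (intro emeasure_lborel_rectangle[OF BC(1)]) (auto simp: A'_def)
    also have "\<dots> = (\<Prod>b\<in>B. emeasure lborel (A' b)) * (\<Prod>b\<in>C. emeasure lborel (A' b))"
      using BC(2) by (intro prod.union_disjoint) auto
    also have "(\<Prod>b\<in>C. emeasure lborel (A' b)) = 1"
      using BC(2) by (intro prod.neutral) (auto simp: A'_def)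
    also have "(\<Prod>b\<in>B. emeasure lborel (A' b)) = (\<Prod>b\<in>B. emeasure lborel (A b))"
      by (simp add: A'_def)
    finally show "emeasure (distr (density lborel (indicator Q)) (\<Pi>\<^sub>M b\<in>B. lborel) r) (Pi\<^sub>E B A) = (\<Prod>b\<in>B. emeasure lborel (A b))"
      by simp
  qed simp_all
  note eq = this
  have "emeasure (subspace_lborel H) S =
      emeasure (distr (distr (density lborel (indicator Q)) (\<Pi>\<^sub>M b\<in>B. lborel) r) borel (\<lambda>f. \<Sum>b\<in>B. f b *\<^sub>R b)) S"
    by (simp add: subspace_lborel_def Let_def B_def[symmetric] eq)
  also have "\<dots> = emeasure (density lborel (indicator Q)) {x. (\<Sum>b\<in>B. (x \<bullet> b) *\<^sub>R b) \<in> S}"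
    by (subst distr_distr, measurable, subst emeasure_distr) (auto simp: r_def vimage_def)
  also have "\<dots> = emeasure lborel (Q \<inter> {x. (\<Sum>b\<in>B. (x \<bullet> b) *\<^sub>R b) \<in> S})"
    by (intro dens) measurable
  also have "Q \<inter> {x. (\<Sum>b\<in>B. (x \<bullet> b) *\<^sub>R b) \<in> S} = unit_cylinder H C S"
    by (auto simp: Q_def unit_cylinder_def orth_proj_eq_sum[OF B])
  finally show ?thesis .
qed

text \<open>
  A diagonal map in an orthonormal basis is conjugate, by a rotation, to a diagonal map in the
  standard basis, where the Jacobian is the product of the entries.
\<close>

lemma emeasure_lborel_stretch:
  fixes B :: "'a::euclidean_space set"
  assumes B: "orthonormal_basis UNIV B" and c: "\<And>b. b \<in> B \<Longrightarrow> c b > 0" and A[measurable]: "A \<in> sets borel"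
  shows "emeasure lborel A =
    ennreal (\<Prod>b\<in>B. c b) * emeasure lborel {x. v + (\<Sum>b\<in>B. (c b * (x \<bullet> b)) *\<^sub>R b) \<in> A}"
proof -
  obtain R :: "'a \<Rightarrow> 'a" where R: "orthogonal_transformation R" and bij: "bij_betw R Basis B"
    using orthonormal_basis_rotation[OF B] .
  have lin: "linear R" using R by (rule orthogonal_transformation_linear)
  have Rm[measurable]: "R \<in> borel_measurable borel"
    using lin by (intro borel_measurable_continuous_onI linear_continuous_on) (simp add: linear_conv_bounded_linear)
  have rot: "emeasure lborel X = emeasure lborel {y. R y \<in> X}" if "X \<in> sets borel" for X
  proof -
    have "emeasure lborel X = emeasure (distr lborel borel R) X"
      by (simp add: lborel_distr_orthogonal[OF R])
    also have "\<dots> = emeasure lborel {y. R y \<in> X}"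
      using that by (subst emeasure_distr) (auto simp: vimage_def)
    finally show ?thesis .
  qed
  obtain u where u: "R u = v" using orthogonal_transformation_surj[OF R] by (metis surjD)
  have cR: "c (R i) > 0" if "i \<in> Basis" for i using c bij that by (auto simp: bij_betw_def)
  define Y where "Y = {y. R y \<in> A}"
  have Y[measurable]: "Y \<in> sets borel" unfolding Y_def by measurable
  define \<Lambda> where "\<Lambda> y = u + (\<Sum>i\<in>Basis. (c (R i) * (y \<bullet> i)) *\<^sub>R i)" for y
  have \<Lambda>[measurable]: "\<Lambda> \<in> borel_measurable borel" unfolding \<Lambda>_def by measurable
  have "emeasure lborel A = emeasure lborel Y"
    unfolding Y_def by (rule rot) fact
  also have "\<dots> = emeasure (density (distr lborel borel \<Lambda>) (\<lambda>_. ennreal (\<Prod>i\<in>Basis. \<bar>c (R i)\<bar>))) Y"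
    using lborel_affine_euclidean[of "\<lambda>i. c (R i)" u] cR by (force simp: \<Lambda>_def[abs_def])
  also have "\<dots> = ennreal (\<Prod>i\<in>Basis. \<bar>c (R i)\<bar>) * emeasure lborel {y. \<Lambda> y \<in> Y}"
    by (simp add: emeasure_density nn_integral_cmult emeasure_distr vimage_def)
  also have "(\<Prod>i\<in>Basis. \<bar>c (R i)\<bar>) = (\<Prod>b\<in>B. \<bar>c b\<bar>)"
    using prod.reindex_bij_betw[OF bij] .
  also have "\<dots> = (\<Prod>b\<in>B. c b)"
    using c by (intro prod.cong) (auto simp: less_imp_le)
  also have "{y. \<Lambda> y \<in> Y} = {y. R y \<in> {x. v + (\<Sum>b\<in>B. (c b * (x \<bullet> b)) *\<^sub>R b) \<in> A}}"
  proof -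
    have "R (\<Lambda> y) = v + (\<Sum>b\<in>B. (c b * (R y \<bullet> b)) *\<^sub>R b)" for y
    proof -
      have "R (\<Lambda> y) = v + (\<Sum>i\<in>Basis. (c (R i) * (R y \<bullet> R i)) *\<^sub>R R i)"
        using R by (simp add: \<Lambda>_def linear_add[OF lin] u linear_sum[OF lin] linear_scale[OF lin] orthogonal_transformation_def)
      also have "\<dots> = v + (\<Sum>b\<in>B. (c b * (R y \<bullet> b)) *\<^sub>R b)"
        using sum.reindex_bij_betw[OF bij, of "\<lambda>b. (c b * (R y \<bullet> b)) *\<^sub>R b"] by simp
      finally show ?thesis .
    qed
    then show ?thesis by (simp add: Y_def)
  qed
  also have "emeasure lborel \<dots> = emeasure lborel {x. v + (\<Sum>b\<in>B. (c b * (x \<bullet> b)) *\<^sub>R b) \<in> A}"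
    by (rule rot[symmetric]) measurable
  finally show ?thesis .
qed

text \<open>
  The affine map that fixes $q + D$ pointwise and multiplies directions orthogonal to $D$ by $t$.
\<close>

definition dilate_normal :: "'a::euclidean_space set \<Rightarrow> 'a \<Rightarrow> real \<Rightarrow> 'a \<Rightarrow> 'a" where
  "dilate_normal D q t x = q + orth_proj D (x - q) + t *\<^sub>R (x - q - orth_proj D (x - q))"

text \<open>
  In an orthonormal basis of $H$ that extends one of $D$ the map is diagonal, with entry $1$ on the
  basis of $D$ and $t$ on the remaining $\dim H - \dim D$ vectors. Extending it by the identity on
  the complement of $H$ maps the cylinder over $S$ to the cylinder over the image. The case $t = 0$
  is included because the Steiner formula is claimed there too; with $0^0 = 1$ it says that
  nothing is lost when $D = H$ and everything collapses into a null set otherwise.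
\<close>

lemma emeasure_dilate_normal:
  fixes H :: "'a::euclidean_space set"
  assumes H: "subspace H" and D: "subspace D" "D \<subseteq> H" and q: "q \<in> H" and t: "0 \<le> t"
    and S: "S \<subseteq> H" and SB[measurable]: "S \<in> sets borel"
    and TB[measurable]: "dilate_normal D q t ` S \<in> sets borel"
  shows "emeasure (subspace_lborel H) (dilate_normal D q t ` S) =
    ennreal (t ^ (dim H - dim D)) * emeasure (subspace_lborel H) S"
proof -
  obtain BD where BD: "orthonormal_basis D BD" using orthonormal_basis_exists[OF D(1)] by blast
  obtain BN where BN: "orthonormal_basis (complement_in H D) BN"
    using orthonormal_basis_exists[OF subspace_complement_in[OF H]] by blast
  obtain C where C: "orthonormal_basis (complement_in UNIV H) C"
    using orthonormal_basis_exists[OF subspace_complement_in[OF subspace_UNIV]] by blast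
  have BH: "orthonormal_basis H (BD \<union> BN)" and dj1: "BD \<inter> BN = {}"
    using orthonormal_basis_extend[OF H D(2) BD BN] by auto
  have BU: "orthonormal_basis UNIV (BD \<union> BN \<union> C)" and dj2: "(BD \<union> BN) \<inter> C = {}"
    using orthonormal_basis_extend[OF subspace_UNIV _ BH C] by auto
  have fin[simp]: "finite BD" "finite BN" "finite C" using BD BN C orthonormal_basisD(1) by auto
  have cardBN: "card BN = dim H - dim D"
    using orthonormal_basisD(4)[OF BH] orthonormal_basisD(4)[OF BD] dj1 by (simp add: card_Un_disjoint)
  define \<gamma> where "\<gamma> b = (if b \<in> BN then t else 1)" for b
  have \<gamma>1: "\<gamma> b = t" if "b \<in> BN" for b using that by (simp add: \<gamma>_def)
  have \<gamma>2: "\<gamma> b = 1" if "b \<in> BD \<union> C" for b using that dj1 dj2 by (auto simp: \<gamma>_def)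
  let ?T = "dilate_normal D q t"
  have expand: "(\<Sum>b\<in>BD \<union> BN. (x \<bullet> b) *\<^sub>R b) = x" if "x \<in> H" for x
    using orth_proj_eq_sum[OF BH] orth_proj_self[OF H that] by simp
  have T_eq: "?T z = (\<Sum>b\<in>BD \<union> BN. (q \<bullet> b + \<gamma> b * ((z - q) \<bullet> b)) *\<^sub>R b)" if z: "z \<in> H" for z
  proof -
    have zq: "z - q \<in> H" using z q H by (simp add: subspace_diff)
    have *: "z - q - orth_proj D (z - q) = (\<Sum>b\<in>BN. ((z - q) \<bullet> b) *\<^sub>R b)"
      using expand[OF zq] by (simp add: orth_proj_eq_sum[OF BD] sum.union_disjoint[OF _ _ dj1] algebra_simps)
    have "(\<Sum>b\<in>BD \<union> BN. (q \<bullet> b + \<gamma> b * ((z - q) \<bullet> b)) *\<^sub>R b) =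
        (\<Sum>b\<in>BD \<union> BN. (q \<bullet> b) *\<^sub>R b) + (\<Sum>b\<in>BD \<union> BN. (\<gamma> b * ((z - q) \<bullet> b)) *\<^sub>R b)"
      by (simp add: scaleR_add_left sum.distrib)
    also have "\<dots> = q + (\<Sum>b\<in>BD \<union> BN. (\<gamma> b * ((z - q) \<bullet> b)) *\<^sub>R b)"
      by (simp only: expand[OF q])
    also have "(\<Sum>b\<in>BD \<union> BN. (\<gamma> b * ((z - q) \<bullet> b)) *\<^sub>R b) =
      (\<Sum>b\<in>BD. ((z - q) \<bullet> b) *\<^sub>R b) + t *\<^sub>R (\<Sum>b\<in>BN. ((z - q) \<bullet> b) *\<^sub>R b)"
      by (simp add: sum.union_disjoint[OF _ _ dj1] \<gamma>1 \<gamma>2 scaleR_sum_right)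
    finally show ?thesis
      unfolding dilate_normal_def * by (simp add: orth_proj_eq_sum[OF BD] add.assoc)
  qed
  have T_H: "?T z \<in> H" if "z \<in> H" for z
    unfolding T_eq[OF that] using orthonormal_basisD(5)[OF BH] H
    by (intro subspace_sum subspace_scale) auto
  have T_coord: "?T z \<bullet> b = q \<bullet> b + \<gamma> b * ((z - q) \<bullet> b)" if "z \<in> H" "b \<in> BD \<union> BN" for z b
    unfolding T_eq[OF that(1)] by (rule inner_sum_orthonormal[OF BH that(2)])
  have eqI: "x = y" if "x \<in> H" "y \<in> H" "\<And>b. b \<in> BD \<union> BN \<Longrightarrow> x \<bullet> b = y \<bullet> b" for x y
    using expand[OF that(1)] expand[OF that(2)] that(3) by (metis (no_types, lifting) sum.cong)
  show ?thesis
  proof (cases "t = 0")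
    case True
    show ?thesis
    proof (cases "BN = {}")
      case True
      then have "?T z = z" if "z \<in> S" for z
        using that S T_H[of z] T_coord[of z] \<gamma>2 by (intro eqI) (auto simp: inner_diff_left)
      then have "?T ` S = S" by force
      then show ?thesis using True cardBN by simp
    next
      case False
      then obtain b where b: "b \<in> BN" by blast
      \<comment> \<open>For $t = 0$ the image lies in the hyperplane where the $b$-coordinate is that of $q$.\<close>
      define A where "A b' = (if b' = b then {q \<bullet> b} else UNIV)" for b'
      have "unit_cylinder H C (?T ` S) \<subseteq> {x. \<forall>b'\<in>BD \<union> BN \<union> C. x \<bullet> b' \<in> A b'}"
      proof clarify
        fix x b' assume "x \<in> unit_cylinder H C (?T ` S)"
        then obtain s where s: "s \<in> S" "orth_proj H x = ?T s" by (auto simp: unit_cylinder_def)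
        have "x \<bullet> b = orth_proj H x \<bullet> b"
          unfolding orth_proj_eq_sum[OF BH] using b by (intro inner_sum_orthonormal[OF BH, symmetric]) auto
        also have "\<dots> = q \<bullet> b" using s S b T_coord[of s b] \<open>t = 0\<close> \<gamma>1 by auto
        finally show "x \<bullet> b' \<in> A b'" by (auto simp: A_def)
      qed
      then have "emeasure lborel (unit_cylinder H C (?T ` S)) \<le> emeasure lborel {x. \<forall>b'\<in>BD \<union> BN \<union> C. x \<bullet> b' \<in> A b'}"
      proof (rule emeasure_mono)
        have [measurable]: "A b' \<in> sets borel" for b' by (simp add: A_def)
        show "{x. \<forall>b'\<in>BD \<union> BN \<union> C. x \<bullet> b' \<in> A b'} \<in> sets lborel"
          using fin by measurable
      qed
      also have "\<dots> = (\<Prod>b'\<in>BD \<union> BN \<union> C. emeasure lborel (A b'))"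
        by (rule emeasure_lborel_rectangle[OF BU]) (auto simp: A_def)
      also have "\<dots> = 0"
        using b by (intro prod_zero) (auto intro!: bexI[of _ b] simp: A_def)
      finally have "emeasure (subspace_lborel H) (?T ` S) = 0"
        by (simp add: emeasure_subspace_lborel[OF H C TB])
      moreover have "card BN > 0" using b by (auto simp: card_gt_0_iff)
      ultimately show ?thesis using \<open>t = 0\<close> cardBN by (simp add: power_0_left)
    qed
  next
    case False
    then have t0: "t > 0" using t by simp
    let ?B = "BD \<union> BN \<union> C"
    have inj: "x = y" if "?T x = ?T y" "x \<in> H" "y \<in> H" for x y
    proof (rule eqI[OF that(2,3)])
      fix b assume b: "b \<in> BD \<union> BN"
      then have "\<gamma> b * ((x - q) \<bullet> b) = \<gamma> b * ((y - q) \<bullet> b)"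
        using T_coord[OF that(2) b] T_coord[OF that(3) b] that(1) by auto
      moreover have "\<gamma> b \<noteq> 0" using t0 by (simp add: \<gamma>_def)
      ultimately show "x \<bullet> b = y \<bullet> b" by (simp add: inner_diff_left)
    qed
    \<comment> \<open>The extension of the dilation to the ambient space; its translation part makes $q$ a fixed point.\<close>
    define v where "v = q - (\<Sum>b\<in>?B. (\<gamma> b * (q \<bullet> b)) *\<^sub>R b)"
    define \<Lambda> where "\<Lambda> x = v + (\<Sum>b\<in>?B. (\<gamma> b * (x \<bullet> b)) *\<^sub>R b)" for x
    have \<Lambda>: "\<Lambda> x \<bullet> b = q \<bullet> b + \<gamma> b * ((x - q) \<bullet> b)" if "b \<in> ?B" for x b
      unfolding \<Lambda>_def v_def inner_add_left inner_diff_left inner_sum_orthonormal[OF BU that]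
      by (simp add: algebra_simps)
    have \<Lambda>_proj: "orth_proj H (\<Lambda> x) = ?T (orth_proj H x)" for x
    proof (rule eqI)
      show "orth_proj H (\<Lambda> x) \<in> H" using H by (rule orth_proj_mem)
      show "?T (orth_proj H x) \<in> H" by (intro T_H orth_proj_mem H)
      fix b assume b: "b \<in> BD \<union> BN"
      have pr: "orth_proj H y \<bullet> b = y \<bullet> b" for y
        unfolding orth_proj_eq_sum[OF BH] using b by (rule inner_sum_orthonormal[OF BH])
      show "orth_proj H (\<Lambda> x) \<bullet> b = ?T (orth_proj H x) \<bullet> b"
        using b by (simp add: pr T_coord[OF orth_proj_mem[OF H] b] \<Lambda> inner_diff_left)
    qed
    have "{x. \<Lambda> x \<in> unit_cylinder H C (?T ` S)} = unit_cylinder H C S"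
    proof -
      have "?T (orth_proj H x) \<in> ?T ` S \<longleftrightarrow> orth_proj H x \<in> S" for x
        using inj S orth_proj_mem[OF H] by (auto simp: image_iff)
      moreover have "\<Lambda> x \<bullet> b = x \<bullet> b" if "b \<in> C" for x b
        using that by (simp add: \<Lambda> \<gamma>2 inner_diff_left)
      ultimately show ?thesis by (simp add: unit_cylinder_def \<Lambda>_proj)
    qed
    moreover have "\<gamma> b > 0" for b using t0 by (simp add: \<gamma>_def)
    ultimately have "emeasure lborel (unit_cylinder H C (?T ` S)) =
        ennreal (\<Prod>b\<in>?B. \<gamma> b) * emeasure lborel (unit_cylinder H C S)"
      using emeasure_lborel_stretch[OF BU, of \<gamma> "unit_cylinder H C (?T ` S)" v] t0 H
      by (simp add: \<Lambda>_def[symmetric] borel_unit_cylinder)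
    moreover have "(\<Prod>b\<in>?B. \<gamma> b) = t ^ card BN"
      using dj1 dj2 by (simp add: prod.union_disjoint \<gamma>1 \<gamma>2)
    ultimately show ?thesis
      by (simp add: emeasure_subspace_lborel[OF H C] cardBN)
  qed
qed

text \<open>
  A bound that is uniform in $H$, including its dimension: the cylinder over a set of radius $r$ lies
  in a ball of radius $r + \dim H^\perp$.
\<close>

lemma emeasure_subspace_lborel_le_ball:
  fixes H :: "'a::euclidean_space set"
  assumes H: "subspace H" and S: "S \<in> sets borel" "S \<subseteq> cball 0 r"
  shows "emeasure (subspace_lborel H) S \<le> emeasure lborel (cball (0::'a) (r + DIM('a)))"
proof -
  obtain B where B: "orthonormal_basis H B" using orthonormal_basis_exists[OF H] by blast
  obtain C where C: "orthonormal_basis (complement_in UNIV H) C"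
    using orthonormal_basis_exists[OF subspace_complement_in[OF subspace_UNIV]] by blast
  have BU: "orthonormal_basis UNIV (B \<union> C)" and dj: "B \<inter> C = {}"
    using orthonormal_basis_extend[OF subspace_UNIV _ B C] by auto
  have fin[simp]: "finite B" "finite C" using B C orthonormal_basisD(1) by auto
  have "card C \<le> DIM('a)"
    using orthonormal_basisD(4)[OF C] dim_subset_UNIV[of "complement_in UNIV H"] by simp
  have "unit_cylinder H C S \<subseteq> cball 0 (r + DIM('a))"
  proof
    fix x assume x: "x \<in> unit_cylinder H C S"
    have "x = orth_proj UNIV x" by (simp add: orth_proj_self)
    also have "\<dots> = orth_proj H x + (\<Sum>c\<in>C. (x \<bullet> c) *\<^sub>R c)"
      by (simp add: orth_proj_eq_sum[OF BU] orth_proj_eq_sum[OF B] sum.union_disjoint[OF _ _ dj])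
    finally have "norm x \<le> norm (orth_proj H x) + norm (\<Sum>c\<in>C. (x \<bullet> c) *\<^sub>R c)"
      by (metis norm_triangle_ineq)
    also have "norm (orth_proj H x) \<le> r" using x S by (auto simp: unit_cylinder_def)
    also have "norm (\<Sum>c\<in>C. (x \<bullet> c) *\<^sub>R c) \<le> (\<Sum>c\<in>C. 1)"
      using x C by (intro sum_norm_le) (auto simp: unit_cylinder_def orthonormal_basis_def)
    also have "\<dots> \<le> DIM('a)" using \<open>card C \<le> DIM('a)\<close> by simp
    finally show "x \<in> cball 0 (r + DIM('a))" by simp
  qed
  then show ?thesis
    unfolding emeasure_subspace_lborel[OF H C S(1)] by (intro emeasure_mono) auto
qed

section \<open>The Steiner formula for polytopes\<close>

definition polyhedron_in :: "'a::euclidean_space set \<Rightarrow> ('a \<times> real) set \<Rightarrow> 'a set" where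
  "polyhedron_in H X = {x \<in> H. \<forall>(a, b)\<in>X. a \<bullet> x \<le> b}"

text \<open>
  The constraints that hold with equality at $p$. The points of a polyhedron with a given active set
  form the relative interior of one of its faces (or the empty set), so active sets serve as names
  for the faces.
\<close>

definition active :: "('a::euclidean_space \<times> real) set \<Rightarrow> 'a \<Rightarrow> ('a \<times> real) set" where
  "active X p = {(a, b) \<in> X. a \<bullet> p = b}"

definition face_directions :: "'a::euclidean_space set \<Rightarrow> ('a \<times> real) set \<Rightarrow> 'a set" where
  "face_directions H I = {x \<in> H. \<forall>(a, b)\<in>I. a \<bullet> x = 0}"

text \<open>
  The part of the parallel body at distance $t$ that retracts, under the nearest point map, to the
  relatively open face named by $I$.
\<close>

definition layer :: "'a::euclidean_space set \<Rightarrow> ('a \<times> real) set \<Rightarrow> ('a \<times> real) set \<Rightarrow> real \<Rightarrow> 'a set" where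
  "layer H X I t = {x \<in> H. active X (closest_point (polyhedron_in H X) x) = I \<and>
     dist x (closest_point (polyhedron_in H X) x) \<le> t}"

lemma subspace_face_directions: "subspace H \<Longrightarrow> subspace (face_directions H I)"
  by (simp add: face_directions_def subspace_def inner_add_right case_prod_beta)

lemma polyhedron_in_eq_Inter:
  "polyhedron_in H X = H \<inter> (\<Inter>c\<in>X. {x. fst c \<bullet> x \<le> snd c})"
  by (auto simp: polyhedron_in_def case_prod_beta)

lemma closed_polyhedron_in: "subspace H \<Longrightarrow> closed (polyhedron_in H X)"
  unfolding polyhedron_in_eq_Inter
  by (intro closed_Int closed_INT ballI closed_halfspace_le closed_subspace)

lemma convex_polyhedron_in: "subspace H \<Longrightarrow> convex (polyhedron_in H X)"
  unfolding polyhedron_in_eq_Inter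
  by (intro convex_Int convex_INT convex_halfspace_le subspace_imp_convex)

text \<open>
  The converse of the obtuse angle property of nearest points: expand
  $|x - y|^2$ around $p$.
\<close>

lemma closest_point_eqI:
  fixes p :: "'a::euclidean_space"
  assumes "closed A" "convex A" "p \<in> A" "\<And>y. y \<in> A \<Longrightarrow> (x - p) \<bullet> (y - p) \<le> 0"
  shows "closest_point A x = p"
proof (rule closest_point_unique[symmetric, OF assms(2,1,3)], intro ballI)
  fix y assume "y \<in> A"
  have "(dist x y)\<^sup>2 = (dist x p)\<^sup>2 - 2 * ((x - p) \<bullet> (y - p)) + (norm (y - p))\<^sup>2"
    unfolding dist_norm power2_norm_eq_inner by (simp add: algebra_simps inner_commute)
  then have "(dist x p)\<^sup>2 \<le> (dist x y)\<^sup>2" using assms(4)[OF \<open>y \<in> A\<close>] zero_le_power2[of "norm (y - p)"] by linarith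
  then show "dist x p \<le> dist x y" by (rule power2_le_imp_le) simp
qed

lemma orth_proj_eqI:
  assumes "subspace D" "y \<in> D" "\<And>z. z \<in> D \<Longrightarrow> orthogonal (x - y) z"
  shows "orth_proj D x = y"
proof -
  obtain B where B: "orthonormal_basis D B" using orthonormal_basis_exists[OF assms(1)] by blast
  have "x \<bullet> b = y \<bullet> b" if "b \<in> B" for b
    using assms(3)[OF orthonormal_basisD(5)[OF B that]] by (simp add: orthogonal_def inner_diff_left)
  then have "orth_proj D x = orth_proj D y" by (simp add: orth_proj_eq_sum[OF B])
  then show ?thesis using orth_proj_self assms by simp
qed

text \<open>
  A short step from $p$ in a direction that is tangent to all active constraints stays inside, since
  the inactive ones have slack. An outer normal $v$ at $p$ cannot increase along it.
\<close>

lemma inner_face_direction_le: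
  assumes H: "subspace H" and X: "finite X" and p: "p \<in> polyhedron_in H X"
    and v: "\<And>y. y \<in> polyhedron_in H X \<Longrightarrow> v \<bullet> (y - p) \<le> 0"
    and d: "d \<in> face_directions H (active X p)"
  shows "v \<bullet> d \<le> 0"
proof -
  have "\<forall>\<^sub>F e in at_right (0::real). \<forall>c\<in>X. fst c \<bullet> (p + e *\<^sub>R d) \<le> snd c"
  proof (intro eventually_ball_finite[OF X] ballI)
    fix c assume c: "c \<in> X"
    show "\<forall>\<^sub>F e in at_right (0::real). fst c \<bullet> (p + e *\<^sub>R d) \<le> snd c"
    proof (cases "fst c \<bullet> p = snd c")
      case True
      then have "c \<in> active X p" using c by (auto simp: active_def)
      then have "fst c \<bullet> d = 0" using d by (auto simp: face_directions_def)
      then show ?thesis using True by (simp add: inner_add_right)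
    next
      case False
      then have "fst c \<bullet> p < snd c" using p c by (force simp: polyhedron_in_def)
      moreover have "((\<lambda>e. fst c \<bullet> (p + e *\<^sub>R d)) \<longlongrightarrow> fst c \<bullet> (p + 0 *\<^sub>R d)) (at_right 0)"
        by (intro tendsto_intros)
      ultimately have "\<forall>\<^sub>F e in at_right (0::real). fst c \<bullet> (p + e *\<^sub>R d) < snd c"
        by (intro order_tendstoD(2)) auto
      then show ?thesis by eventually_elim simp
    qed
  qed
  then have "\<forall>\<^sub>F e in at_right (0::real). e > 0 \<and> (\<forall>c\<in>X. fst c \<bullet> (p + e *\<^sub>R d) \<le> snd c)"
    using eventually_at_right_less by (rule eventually_elim2) auto
  then obtain e where e: "e > 0" "\<forall>c\<in>X. fst c \<bullet> (p + e *\<^sub>R d) \<le> snd c"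
    using eventually_happens by force
  have "p + e *\<^sub>R d \<in> H"
    using p d H by (intro subspace_add subspace_scale) (auto simp: polyhedron_in_def face_directions_def)
  then have "p + e *\<^sub>R d \<in> polyhedron_in H X" using e(2) by (auto simp: polyhedron_in_def)
  then have "e * (v \<bullet> d) \<le> 0" using v by fastforce
  then show ?thesis using e(1) by (simp add: mult_le_0_iff)
qed

lemma normal_orthogonal_face_directions:
  assumes H: "subspace H" and X: "finite X" and p: "p \<in> polyhedron_in H X"
    and v: "\<And>y. y \<in> polyhedron_in H X \<Longrightarrow> v \<bullet> (y - p) \<le> 0"
    and d: "d \<in> face_directions H (active X p)"
  shows "v \<bullet> d = 0"
proof -
  have "- d \<in> face_directions H (active X p)"
    using d subspace_face_directions[OF H] by (simp add: subspace_neg)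
  from inner_face_direction_le[OF H X p v this] inner_face_direction_le[OF H X p v d]
  show ?thesis by simp
qed

text \<open>
  A point of the layer is $p + v$ with $p$ in the face and $v$ an outer normal at $p$. Here $v$ is
  orthogonal to the face directions, while $p - q$ is a face direction, so the dilation about $q$
  sends $p + v$ to $p + tv$; the nearest point of the latter is still $p$.
\<close>

lemma layer_eq_dilate:
  assumes H: "subspace H" and X: "finite X" and q: "q \<in> polyhedron_in H X" "active X q = I" and t: "0 \<le> t"
  shows "layer H X I t = dilate_normal (face_directions H I) q t ` layer H X I 1"
proof -
  let ?A = "polyhedron_in H X" and ?D = "face_directions H I"
  let ?p = "closest_point ?A"
  have A: "closed ?A" "convex ?A" "?A \<noteq> {}"
    using closed_polyhedron_in[OF H] convex_polyhedron_in[OF H] q by auto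
  have AH: "?A \<subseteq> H" by (auto simp: polyhedron_in_def)
  have move: "?p (p + s *\<^sub>R v) = p \<and> dilate_normal ?D q s (p + v) = p + s *\<^sub>R v"
    if p: "p \<in> ?A" "active X p = I" and v: "\<And>y. y \<in> ?A \<Longrightarrow> v \<bullet> (y - p) \<le> 0" and "0 \<le> s" for p v s
  proof
    show "?p (p + s *\<^sub>R v) = p"
      using A p v \<open>0 \<le> s\<close> by (intro closest_point_eqI) (auto simp: mult_nonneg_nonpos)
    have "p - q \<in> ?D"
    proof -
      have "p - q \<in> H" using p q AH H by (auto intro: subspace_diff)
      moreover have "a \<bullet> (p - q) = 0" if "(a, b) \<in> I" for a b
      proof -
        have "a \<bullet> p = b" using that p(2) by (auto simp: active_def)
        moreover have "a \<bullet> q = b" using that q(2) by (auto simp: active_def)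
        ultimately show ?thesis by (simp add: inner_diff_right)
      qed
      ultimately show ?thesis by (auto simp: face_directions_def)
    qed
    moreover have "v \<bullet> d = 0" if "d \<in> ?D" for d
      using normal_orthogonal_face_directions[OF H X p(1) v, of d] that p(2) by simp
    ultimately have "orth_proj ?D (p + v - q) = p - q"
      using subspace_face_directions[OF H] by (intro orth_proj_eqI) (auto simp: orthogonal_def)
    then show "dilate_normal ?D q s (p + v) = p + s *\<^sub>R v"
      by (simp add: dilate_normal_def)
  qed
  have normal: "(x - ?p x) \<bullet> (y - ?p x) \<le> 0" if "y \<in> ?A" for x y
    using closest_point_dot[OF A(2,1) that] .
  have pA: "?p x \<in> ?A" for x using closest_point_in_set[OF A(1,3)] .
  show ?thesis
  proof (intro subset_antisym subsetI)
    fix x assume x: "x \<in> layer H X I t"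
    define p where "p = ?p x"
    \<comment> \<open>For $t = 0$ division by zero gives $v = 0$, which is correct because then $x = p$.\<close>
    define v where "v = (1 / t) *\<^sub>R (x - p)"
    have tv: "t *\<^sub>R v = x - p" and nv: "norm v \<le> 1"
      using x t by (auto simp: v_def layer_def p_def dist_norm divide_le_eq_1)
    have p: "p \<in> ?A" "active X p = I" using x pA by (auto simp: layer_def p_def)
    have v: "v \<bullet> (y - p) \<le> 0" if "y \<in> ?A" for y
    proof -
      have "v \<bullet> (y - p) = (1 / t) * ((x - p) \<bullet> (y - p))" by (simp add: v_def)
      moreover have "(x - p) \<bullet> (y - p) \<le> 0" using normal[OF that] by (simp add: p_def)
      ultimately show ?thesis using t by (metis mult_nonneg_nonpos zero_le_divide_1_iff)
    qed
    have "p + v \<in> H"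
      using x p AH H unfolding v_def layer_def by (intro subspace_add subspace_scale subspace_diff) auto
    then have "p + v \<in> layer H X I 1"
      using move[OF p v, of 1] p nv by (simp add: layer_def dist_norm)
    moreover have "x = dilate_normal ?D q t (p + v)"
      using move[OF p v t] tv by simp
    ultimately show "x \<in> dilate_normal ?D q t ` layer H X I 1" by blast
  next
    fix x assume "x \<in> dilate_normal ?D q t ` layer H X I 1"
    then obtain y where y: "y \<in> layer H X I 1" "x = dilate_normal ?D q t y" by blast
    define p where "p = ?p y"
    define v where "v = y - p"
    have p: "p \<in> ?A" "active X p = I" using y pA by (auto simp: layer_def p_def)
    have v: "v \<bullet> (z - p) \<le> 0" if "z \<in> ?A" for z using normal[OF that] by (simp add: p_def v_def)
    have x: "x = p + t *\<^sub>R v" "?p x = p" using move[OF p v t] y(2) by (auto simp: v_def)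
    have "norm v \<le> 1" using y(1) by (simp add: layer_def v_def p_def dist_norm)
    then have "dist x (?p x) \<le> t" using t x by (simp add: dist_norm mult_left_le)
    moreover have "x \<in> H"
      using y(1) p AH H unfolding x(1) v_def layer_def by (intro subspace_add subspace_scale subspace_diff) auto
    ultimately show "x \<in> layer H X I t" using x p by (simp add: layer_def)
  qed
qed

lemma parallel_body_eq_closest_point:
  assumes H: "subspace H" and A: "closed A" "A \<noteq> {}" "A \<subseteq> H" and t: "0 \<le> t"
  shows "parallel_body H A t = {x \<in> H. dist x (closest_point A x) \<le> t}"
proof (intro subset_antisym subsetI)
  fix x assume "x \<in> parallel_body H A t"
  then obtain a u where x: "x = a + t *\<^sub>R u" "a \<in> A" "u \<in> H" "norm u \<le> 1"
    by (auto simp: parallel_body_def)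
  have "dist x (closest_point A x) \<le> dist x a" using closest_point_le[OF A(1) x(2)] .
  also have "\<dots> \<le> t" using x t by (simp add: dist_norm mult_left_le)
  finally show "x \<in> {x \<in> H. dist x (closest_point A x) \<le> t}"
    using x A H by (auto intro!: subspace_add subspace_scale)
next
  fix x assume x: "x \<in> {x \<in> H. dist x (closest_point A x) \<le> t}"
  let ?p = "closest_point A x"
  define u where "u = (1 / t) *\<^sub>R (x - ?p)"
  have p: "?p \<in> A" using closest_point_in_set[OF A(1,2)] .
  have "x = ?p + t *\<^sub>R u" "norm u \<le> 1"
    using x t by (auto simp: u_def dist_norm divide_le_eq_1)
  moreover have "u \<in> H" using x p A H unfolding u_def by (intro subspace_scale subspace_diff) auto
  ultimately show "x \<in> parallel_body H A t" using p by (auto simp: parallel_body_def)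
qed

lemma borel_layer:
  assumes H: "subspace H" and X: "finite X" and ne: "polyhedron_in H X \<noteq> {}"
  shows "layer H X I t \<in> sets borel"
proof -
  let ?p = "closest_point (polyhedron_in H X)"
  have p[measurable]: "?p \<in> borel_measurable borel"
    using continuous_on_closest_point[OF convex_polyhedron_in[OF H] closed_polyhedron_in[OF H] ne]
    by (rule borel_measurable_continuous_onI)
  have H'[measurable]: "H \<in> sets borel" using closed_subspace[OF H] by (rule borel_closed)
  have "active X p = I \<longleftrightarrow> I \<subseteq> X \<and> (\<forall>c\<in>X. fst c \<bullet> p = snd c \<longleftrightarrow> c \<in> I)" for p
    by (fastforce simp: active_def)
  then have "layer H X I t = {x. x \<in> H \<and> I \<subseteq> X \<and> (\<forall>c\<in>X. fst c \<bullet> ?p x = snd c \<longleftrightarrow> c \<in> I) \<and> dist x (?p x) \<le> t}"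
    by (simp add: layer_def)
  also have "\<dots> \<in> sets borel" using X by measurable
  finally show ?thesis .
qed

lemma emeasure_layer_finite:
  assumes H: "subspace H" and X: "finite X" and ne: "polyhedron_in H X \<noteq> {}" and bd: "bounded (polyhedron_in H X)"
  shows "emeasure (subspace_lborel H) (layer H X I s) \<noteq> top"
proof -
  let ?p = "closest_point (polyhedron_in H X)"
  obtain r where r: "\<And>x. x \<in> polyhedron_in H X \<Longrightarrow> norm x \<le> r" using bd by (auto simp: bounded_iff)
  have "layer H X I s \<subseteq> cball 0 (r + s)"
  proof
    fix x assume "x \<in> layer H X I s"
    then have "dist x (?p x) \<le> s" by (simp add: layer_def)
    moreover have "norm x \<le> norm (?p x) + dist x (?p x)"
      using norm_triangle_sub[of x "?p x"] by (simp add: dist_norm)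
    moreover have "norm (?p x) \<le> r"
      by (intro r closest_point_in_set closed_polyhedron_in H ne)
    ultimately show "x \<in> cball 0 (r + s)" by simp
  qed
  from emeasure_subspace_lborel_le_ball[OF H borel_layer[OF H X ne] this]
  show ?thesis using emeasure_lborel_cball_finite by (metis infinity_ennreal_def leD top.not_eq_extremum)
qed

text \<open>
  The parallel body is the disjoint union of the layers, one for each set $I$ of constraints, and the
  layer of $I$ grows like $t$ to the codimension of the face: sorting the summands by codimension
  gives the polynomial. Sets $I$ that name no face have an empty layer and contribute zero.
\<close>

theorem steiner_coeffs_polyhedron_in:
  assumes H: "subspace H" and X: "finite X" and ne: "polyhedron_in H X \<noteq> {}" and bd: "bounded (polyhedron_in H X)"
  shows "steiner_coeffs H (polyhedron_in H X) (\<lambda>j.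
     (\<Sum>I | I \<subseteq> X \<and> dim H - dim (face_directions H I) = j. measure (subspace_lborel H) (layer H X I 1)) / (dim H choose j))"
  unfolding steiner_coeffs_def
proof (intro allI impI)
  fix t :: real assume t: "0 \<le> t"
  let ?A = "polyhedron_in H X" and ?M = "subspace_lborel H" and ?e = "\<lambda>I. dim H - dim (face_directions H I)"
  let ?m = "\<lambda>I. measure ?M (layer H X I 1)"
  have setsM: "sets ?M = sets borel" by (simp add: subspace_lborel_def Let_def)
  have sets: "layer H X I s \<in> sets ?M" for I s using borel_layer[OF H X ne] setsM by simp
  have pA: "closest_point ?A x \<in> ?A" for x using closest_point_in_set[OF closed_polyhedron_in[OF H] ne] .
  have fin: "emeasure ?M (layer H X I s) \<noteq> \<infinity>" for I s
    using emeasure_layer_finite[OF H X ne bd] by simp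
  have scale: "measure ?M (layer H X I t) = t ^ ?e I * ?m I" if I: "I \<subseteq> X" for I
  proof (cases "\<exists>q\<in>?A. active X q = I")
    case True
    then obtain q where q: "q \<in> ?A" "active X q = I" by blast
    let ?D = "face_directions H I"
    have "emeasure ?M (dilate_normal ?D q t ` layer H X I 1) = ennreal (t ^ ?e I) * emeasure ?M (layer H X I 1)"
    proof (rule emeasure_dilate_normal[OF H subspace_face_directions[OF H] _ _ t])
      show "q \<in> H" using q by (simp add: polyhedron_in_def)
      show "dilate_normal ?D q t ` layer H X I 1 \<in> sets borel"
        using borel_layer[OF H X ne] layer_eq_dilate[OF H X q t] by metis
          show "layer H X I 1 \<in> sets borel" by (rule borel_layer[OF H X ne])
    qed (auto simp: face_directions_def layer_def)
    then show ?thesis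
      unfolding layer_eq_dilate[OF H X q t, symmetric] measure_def using t by (simp add: enn2real_mult)
  next
    case False
    then have "layer H X I s = {}" for s using pA by (auto simp: layer_def)
    then show ?thesis by simp
  qed
  have "parallel_body H ?A t = (\<Union>I\<in>Pow X. layer H X I t)"
    using parallel_body_eq_closest_point[OF H closed_polyhedron_in[OF H] ne _ t]
    by (auto simp: layer_def polyhedron_in_def active_def)
  moreover have "disjoint_family_on (\<lambda>I. layer H X I t) (Pow X)"
    by (auto simp: disjoint_family_on_def layer_def)
  ultimately have "measure ?M (parallel_body H ?A t) = (\<Sum>I\<in>Pow X. measure ?M (layer H X I t))"
    using X sets fin by (simp add: measure_finite_Union image_subset_iff)
  also have "\<dots> = (\<Sum>I\<in>Pow X. t ^ ?e I * ?m I)"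
    by (intro sum.cong) (auto simp: scale)
  also have "\<dots> = (\<Sum>j\<le>dim H. \<Sum>I\<in>{I \<in> Pow X. ?e I = j}. t ^ ?e I * ?m I)"
    using X by (intro sum.group[symmetric]) auto
  also have "\<dots> = (\<Sum>j\<le>dim H. real (dim H choose j) * ((\<Sum>I | I \<subseteq> X \<and> ?e I = j. ?m I) / (dim H choose j)) * t ^ j)"
  proof (intro sum.cong refl)
    fix j assume "j \<in> {..dim H}"
    then have "real (dim H choose j) \<noteq> 0" by simp
    moreover have "(\<Sum>I\<in>{I \<in> Pow X. ?e I = j}. t ^ ?e I * ?m I) = t ^ j * (\<Sum>I | I \<subseteq> X \<and> ?e I = j. ?m I)"
      unfolding sum_distrib_left by (intro sum.cong) auto
    ultimately show "(\<Sum>I\<in>{I \<in> Pow X. ?e I = j}. t ^ ?e I * ?m I) =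
        real (dim H choose j) * ((\<Sum>I | I \<subseteq> X \<and> ?e I = j. ?m I) / (dim H choose j)) * t ^ j"
      by simp
  qed
  finally show "measure ?M (parallel_body H ?A t) = \<dots>" .
qed

corollary quermassintegral_polyhedron_in:
  assumes "subspace H" "finite X" "polyhedron_in H X \<noteq> {}" "bounded (polyhedron_in H X)" "j \<le> dim H"
  shows "quermassintegral H j (polyhedron_in H X) =
     (\<Sum>I | I \<subseteq> X \<and> dim H - dim (face_directions H I) = j. measure (subspace_lborel H) (layer H X I 1)) / (dim H choose j)"
  by (rule quermassintegral_eqI[OF steiner_coeffs_polyhedron_in]) (fact assms)+

section \<open>Bounds for quermassintegrals\<close>

lemma polytope_imp_polyhedron_in:
  fixes A :: "'a::euclidean_space set"
  assumes "polytope A" "A \<subseteq> H"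
  obtains X where "finite X" "A = polyhedron_in H X"
proof -
  obtain F where F: "finite F" "A = \<Inter>F" "\<forall>h\<in>F. \<exists>a b. a \<noteq> 0 \<and> h = {x. a \<bullet> x \<le> b}"
    using polytope_imp_polyhedron[OF assms(1)] by (auto simp: polyhedron_def)
  then obtain a b where ab: "\<And>h. h \<in> F \<Longrightarrow> h = {x. a h \<bullet> x \<le> b h}" by metis
  have "x \<in> A \<longleftrightarrow> x \<in> polyhedron_in H ((\<lambda>h. (a h, b h)) ` F)" for x
    using assms(2) ab unfolding F(2) polyhedron_in_def by fastforce
  then show thesis using F(1) that by blast
qed

text \<open>
  All coefficients of the Steiner polynomial are non-negative, so each is at most the value of the
  polynomial at $t = 1$, which is the measure of a set in a ball of radius $r + 1$. The bound depends
  on the polytope and the subspace only through $r$ and the ambient dimension.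
\<close>

lemma quermassintegral_polytope_le:
  fixes A :: "'a::euclidean_space set"
  assumes H: "subspace H" and A: "polytope A" "A \<subseteq> H" "A \<noteq> {}" "A \<subseteq> cball 0 r" and j: "j \<le> dim H"
  shows "quermassintegral H j A \<le> measure lborel (cball (0::'a) (r + 1 + DIM('a)))"
proof -
  obtain X where X: "finite X" and AX: "A = polyhedron_in H X"
    using polytope_imp_polyhedron_in[OF A(1,2)] .
  define w where "w j = (\<Sum>I | I \<subseteq> X \<and> dim H - dim (face_directions H I) = j.
     measure (subspace_lborel H) (layer H X I 1)) / (dim H choose j)" for j
  have w0: "0 \<le> w i" for i unfolding w_def by (intro divide_nonneg_nonneg sum_nonneg) auto
  have steiner: "steiner_coeffs H A w"
    unfolding AX w_def[abs_def] using H X A polytope_imp_bounded[OF A(1)] AX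
    by (intro steiner_coeffs_polyhedron_in) auto
  have "quermassintegral H j A = w j"
    using steiner j by (rule quermassintegral_eqI)
  also have "\<dots> \<le> real (dim H choose j) * w j * 1 ^ j"
  proof -
    have "1 \<le> real (dim H choose j)" using zero_less_binomial[OF j] by linarith
    then show ?thesis using w0[of j] by (simp add: mult_le_cancel_right1)
  qed
  also have "\<dots> \<le> (\<Sum>i\<le>dim H. real (dim H choose i) * w i * 1 ^ i)"
    using j w0 by (intro member_le_sum[of j "{..dim H}" "\<lambda>i. real (dim H choose i) * w i * 1 ^ i"]) auto
  also have "\<dots> = measure (subspace_lborel H) (parallel_body H A 1)"
    using steiner by (simp add: steiner_coeffs_def)
  also have "\<dots> \<le> measure lborel (cball (0::'a) (r + 1 + DIM('a)))"
  proof -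
    let ?P = "parallel_body H A 1"
    have "compact {a + 1 *\<^sub>R u | a u. a \<in> A \<and> u \<in> H \<inter> cball 0 1}"
      using compact_sums[OF polytope_imp_compact[OF A(1)], of "H \<inter> cball 0 1"] closed_subspace[OF H]
      by (simp add: closed_Int_compact)
    then have "?P \<in> sets borel"
      by (simp add: parallel_body_def borel_compact)
    moreover have "?P \<subseteq> cball 0 (r + 1)"
    proof
      fix x assume "x \<in> ?P"
      then obtain a u where "x = a + u" "a \<in> A" "norm u \<le> 1" by (auto simp: parallel_body_def)
      then show "x \<in> cball 0 (r + 1)" using A(4) norm_triangle_ineq[of a u] by force
    qed
    ultimately have "emeasure (subspace_lborel H) ?P \<le> emeasure lborel (cball (0::'a) (r + 1 + DIM('a)))"
      by (rule emeasure_subspace_lborel_le_ball[OF H])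
    then show ?thesis
      unfolding measure_def using emeasure_lborel_cball_finite[of "0::'a" "r + 1 + DIM('a)"] by (intro enn2real_mono) auto
  qed
  finally show ?thesis .
qed

definition coordinate_subspace :: "'a::euclidean_space set \<Rightarrow> 'a set" where
  "coordinate_subspace S = {x. \<forall>i\<in>Basis. i \<notin> S \<longrightarrow> x \<bullet> i = 0}"

definition coordinate_box :: "'a::euclidean_space set \<Rightarrow> ('a \<Rightarrow> real) \<Rightarrow> 'a set" where
  "coordinate_box S s = {x \<in> coordinate_subspace S. \<forall>i\<in>S. 0 \<le> x \<bullet> i \<and> x \<bullet> i \<le> s i}"

lemma subspace_coordinate_subspace: "subspace (coordinate_subspace S)"
  by (auto simp: coordinate_subspace_def subspace_def inner_add_left)

lemma coordinate_subspace_Basis: "coordinate_subspace Basis = UNIV"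
  by (simp add: coordinate_subspace_def)

lemma dim_coordinate_subspace: "S \<subseteq> Basis \<Longrightarrow> dim (coordinate_subspace S) = card S"
  unfolding coordinate_subspace_def by (rule dim_substandard)

lemma orthonormal_basis_coordinate_subspace:
  assumes S: "S \<subseteq> Basis"
  shows "orthonormal_basis (coordinate_subspace S) S"
  unfolding orthonormal_basis_def
proof (intro conjI ballI)
  show "pairwise orthogonal S"
    using S by (auto simp: pairwise_def orthogonal_def inner_Basis subset_eq)
  show "norm b = 1" if "b \<in> S" for b using that S by auto
  show "span S = coordinate_subspace S"
  proof
    show "span S \<subseteq> coordinate_subspace S"
      using S by (intro span_minimal subspace_coordinate_subspace) (auto simp: coordinate_subspace_def inner_Basis subset_eq)
    show "coordinate_subspace S \<subseteq> span S"
    proof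
      fix x assume x: "x \<in> coordinate_subspace S"
      have "x = (\<Sum>i\<in>Basis. (x \<bullet> i) *\<^sub>R i)" by (simp add: euclidean_representation)
      also have "\<dots> = (\<Sum>i\<in>S. (x \<bullet> i) *\<^sub>R i)"
        using S x by (intro sum.mono_neutral_right) (auto simp: coordinate_subspace_def)
      also have "\<dots> \<in> span S" by (intro span_sum span_scale span_base)
      finally show "x \<in> span S" .
    qed
  qed
qed

lemma complement_in_coordinate_subspace:
  assumes S: "S \<subseteq> Basis"
  shows "complement_in UNIV (coordinate_subspace S) = coordinate_subspace (Basis - S)"
proof (intro subset_antisym subsetI)
  fix y assume y: "y \<in> complement_in UNIV (coordinate_subspace S)"
  have "y \<bullet> i = 0" if "i \<in> S" for i
  proof -
    have "i \<in> coordinate_subspace S" using that S by (auto simp: coordinate_subspace_def inner_Basis subset_eq)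
    then show ?thesis using y by (auto simp: complement_in_def orthogonal_def inner_commute)
  qed
  then show "y \<in> coordinate_subspace (Basis - S)" by (auto simp: coordinate_subspace_def)
next
  fix y assume y: "y \<in> coordinate_subspace (Basis - S)"
  have "x \<bullet> y = 0" if "x \<in> coordinate_subspace S" for x
    unfolding euclidean_inner[of x y] using that y by (intro sum.neutral) (auto simp: coordinate_subspace_def)
  then show "y \<in> complement_in UNIV (coordinate_subspace S)" by (auto simp: complement_in_def orthogonal_def)
qed

lemma orth_proj_coordinate_subspace:
  assumes S: "S \<subseteq> Basis" and i: "i \<in> Basis"
  shows "orth_proj (coordinate_subspace S) x \<bullet> i = (if i \<in> S then x \<bullet> i else 0)"
proof (cases "i \<in> S")
  case True
  then show ?thesis
    unfolding orth_proj_eq_sum[OF orthonormal_basis_coordinate_subspace[OF S]]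
    by (simp add: inner_sum_orthonormal[OF orthonormal_basis_coordinate_subspace[OF S]])
next
  case False
  then show ?thesis using orth_proj_mem[OF subspace_coordinate_subspace, of S x] i
    by (simp add: coordinate_subspace_def)
qed

lemma emeasure_coordinate_rectangle:
  assumes S: "S \<subseteq> Basis" and A: "\<And>i. i \<in> S \<Longrightarrow> A i \<in> sets borel"
  shows "emeasure (subspace_lborel (coordinate_subspace S)) {x \<in> coordinate_subspace S. \<forall>i\<in>S. x \<bullet> i \<in> A i} =
    (\<Prod>i\<in>S. emeasure lborel (A i))"
proof -
  let ?H = "coordinate_subspace S" and ?R = "{x \<in> coordinate_subspace S. \<forall>i\<in>S. x \<bullet> i \<in> A i}"
  have fin[simp]: "finite S" using S finite_Basis by (rule finite_subset)
  have C: "orthonormal_basis (complement_in UNIV ?H) (Basis - S)"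
    unfolding complement_in_coordinate_subspace[OF S] by (rule orthonormal_basis_coordinate_subspace) auto
  have [measurable]: "?H \<in> sets borel"
    by (intro borel_closed closed_subspace subspace_coordinate_subspace)
  note A[measurable]
  have R: "?R \<in> sets borel" by measurable
  define A' where "A' i = (if i \<in> S then A i else {0..1})" for i
  have "unit_cylinder ?H (Basis - S) ?R = {x. \<forall>i\<in>Basis. x \<bullet> i \<in> A' i}"
  proof -
    have "orth_proj ?H x \<in> ?R \<longleftrightarrow> (\<forall>i\<in>S. x \<bullet> i \<in> A i)" for x
      using S orth_proj_mem[OF subspace_coordinate_subspace, of S x]
      by (auto simp: orth_proj_coordinate_subspace[OF S] subset_eq)
    then show ?thesis using S by (auto simp: unit_cylinder_def A'_def subset_eq)
  qed
  then have "emeasure (subspace_lborel ?H) ?R = emeasure lborel {x. \<forall>i\<in>Basis. x \<bullet> i \<in> A' i}"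
    using emeasure_subspace_lborel[OF subspace_coordinate_subspace C R] by simp
  also have "\<dots> = (\<Prod>i\<in>Basis. emeasure lborel (A' i))"
    using A by (intro emeasure_lborel_Basis_rectangle) (auto simp: A'_def)
  also have "\<dots> = (\<Prod>i\<in>S. emeasure lborel (A i))"
    using S by (intro prod.mono_neutral_cong_right) (auto simp: A'_def)
  finally show ?thesis .
qed

lemma coordinate_box_eq_polyhedron_in:
  "coordinate_box S s = polyhedron_in (coordinate_subspace S) ((\<lambda>i. (i, s i)) ` S \<union> (\<lambda>i. (- i, 0)) ` S)"
  by (auto simp: coordinate_box_def polyhedron_in_def inner_commute ball_Un)

lemma norm_le_sum_coordinates:
  fixes x :: "'a::euclidean_space" and d :: real
  assumes "\<And>i. i \<in> Basis \<Longrightarrow> \<bar>x \<bullet> i\<bar> \<le> d"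
  shows "norm x \<le> DIM('a) * d"
proof -
  have "norm x \<le> (\<Sum>i\<in>Basis. \<bar>x \<bullet> i\<bar>)" by (rule norm_le_l1)
  also have "\<dots> \<le> (\<Sum>i\<in>(Basis::'a set). d)" using assms by (rule sum_mono)
  finally show ?thesis by simp
qed

text \<open>
  The face of the box on which the coordinates in $J$ are maximal has codimension $|J|$, so its unit
  layer alone bounds the coefficient of $t^{|J|}$ from below. That layer contains a box with sides
  $1/n$ in the directions $J$, where $n$ is the ambient dimension, and $s_i$ in the others. The side lengths $s_i$ with $i \in J$ do not
  enter the bound: a box may be arbitrarily thin in these directions.
\<close>

lemma quermassintegral_coordinate_box_ge:
  fixes S :: "'a::euclidean_space set"
  assumes S: "S \<subseteq> Basis" and J: "J \<subseteq> S" and s: "\<And>i. i \<in> S \<Longrightarrow> 0 < s i"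
  shows "(1 / DIM('a)) ^ card J * (\<Prod>i\<in>S - J. s i) / (card S choose card J)
    \<le> quermassintegral (coordinate_subspace S) (card J) (coordinate_box S s)"
proof -
  let ?H = "coordinate_subspace S" and ?M = "subspace_lborel (coordinate_subspace S)"
  let ?A = "coordinate_box S s"
  define X where "X = (\<lambda>i. (i, s i)) ` S \<union> (\<lambda>i. (- i, 0)) ` S"
  define I where "I = (\<lambda>i. (i, s i)) ` J"
  define \<delta> :: real where "\<delta> = 1 / DIM('a)"
  have \<delta>: "0 < \<delta>" by (simp add: \<delta>_def)
  have fin[simp]: "finite S" "finite J"
    using finite_subset[OF S finite_Basis] finite_subset[OF J] by auto
  have AX: "?A = polyhedron_in ?H X"
    unfolding X_def by (rule coordinate_box_eq_polyhedron_in)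
  have H: "subspace ?H" by (rule subspace_coordinate_subspace)
  have X: "finite X" by (simp add: X_def)
  have "0 \<in> ?A" using s by (auto simp: coordinate_box_def coordinate_subspace_def less_imp_le)
  then have ne: "polyhedron_in ?H X \<noteq> {}" using AX by auto
  have "?A \<subseteq> cball 0 (DIM('a) * (\<Sum>i\<in>S. s i))"
  proof
    fix x assume x: "x \<in> ?A"
    have "\<bar>x \<bullet> i\<bar> \<le> (\<Sum>i\<in>S. s i)" if "i \<in> Basis" for i
    proof (cases "i \<in> S")
      case True
      then have "\<bar>x \<bullet> i\<bar> \<le> s i" using x by (auto simp: coordinate_box_def)
      also have "\<dots> \<le> (\<Sum>i\<in>S. s i)" using True s by (intro member_le_sum) (auto simp: less_imp_le)
      finally show ?thesis .
    next
      case False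
      then have "x \<bullet> i = 0" using x that by (auto simp: coordinate_box_def coordinate_subspace_def)
      then show ?thesis using s by (auto intro!: sum_nonneg simp: less_imp_le)
    qed
    then show "x \<in> cball 0 (DIM('a) * (\<Sum>i\<in>S. s i))" by (simp add: norm_le_sum_coordinates)
  qed
  then have bd: "bounded (polyhedron_in ?H X)"
    unfolding AX using bounded_cball bounded_subset by blast
  have "card J \<le> card S" using J by (simp add: card_mono)
  then have jd: "card J \<le> dim ?H" by (simp add: dim_coordinate_subspace[OF S])
  have IX: "I \<subseteq> X" using J by (auto simp: I_def X_def)
  have "face_directions ?H I = coordinate_subspace (S - J)"
    using J S by (auto simp: face_directions_def I_def coordinate_subspace_def inner_commute)
  moreover have "dim (coordinate_subspace (S - J)) = card S - card J"
    using S J by (subst dim_coordinate_subspace) (auto simp: card_Diff_subset)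
  ultimately have codim: "dim ?H - dim (face_directions ?H I) = card J"
    using \<open>card J \<le> card S\<close> by (simp add: dim_coordinate_subspace[OF S])
  define A where "A i = (if i \<in> J then {s i<..<s i + \<delta>} else {0<..<s i})" for i
  let ?U = "{x \<in> ?H. \<forall>i\<in>S. x \<bullet> i \<in> A i}"
  have "?U \<subseteq> layer ?H X I 1"
  proof
    fix x assume x: "x \<in> ?U"
    \<comment> \<open>The nearest point of the box truncates the coordinates in $J$.\<close>
    define p where "p = (\<Sum>i\<in>Basis. (if i \<in> J then s i else x \<bullet> i) *\<^sub>R i)"
    have p: "p \<bullet> i = (if i \<in> J then s i else x \<bullet> i)" if "i \<in> Basis" for i
      unfolding p_def by (rule inner_sum_left_Basis[OF that])
    have pS: "0 < p \<bullet> i" "p \<bullet> i \<le> s i" "p \<bullet> i = s i \<longleftrightarrow> i \<in> J" if "i \<in> S" for i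
    proof -
      have "x \<bullet> i \<in> A i" using x that by blast
      then show "0 < p \<bullet> i" "p \<bullet> i \<le> s i" "p \<bullet> i = s i \<longleftrightarrow> i \<in> J"
        using that S s[OF that] by (auto simp: p A_def subset_eq)
    qed
    have pA: "p \<in> ?A"
      using x pS J by (auto simp: coordinate_box_def coordinate_subspace_def p less_imp_le)
    have cp: "closest_point ?A x = p"
    proof (rule closest_point_eqI[OF _ _ pA])
      show "closed ?A" "convex ?A"
        unfolding AX by (intro closed_polyhedron_in convex_polyhedron_in H)+
      fix y assume y: "y \<in> ?A"
      show "(x - p) \<bullet> (y - p) \<le> 0"
        unfolding euclidean_inner[of "x - p" "y - p"]
      proof (rule sum_nonpos)
        fix i :: 'a assume i: "i \<in> Basis"
        show "(x - p) \<bullet> i * ((y - p) \<bullet> i) \<le> 0"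
        proof (cases "i \<in> J")
          case True
          then have "i \<in> S" using J by blast
          then have "x \<bullet> i \<in> A i" "y \<bullet> i \<le> s i" using x y by (auto simp: coordinate_box_def)
          then have "0 \<le> (x - p) \<bullet> i" "(y - p) \<bullet> i \<le> 0"
            using True i by (auto simp: inner_diff_left p A_def)
          then show ?thesis by (rule mult_nonneg_nonpos)
        next
          case False
          then show ?thesis using i by (simp add: inner_diff_left p)
        qed
      qed
    qed
    have "active X p = I"
    proof (intro subset_antisym subsetI)
      fix c assume "c \<in> active X p"
      then have c: "c \<in> X" "fst c \<bullet> p = snd c" by (auto simp: active_def)
      from c(1) consider i where "i \<in> S" "c = (i, s i)" | i where "i \<in> S" "c = (- i, 0)"
        by (auto simp: X_def)
      then show "c \<in> I"
      proof cases
        case 1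
        then show ?thesis using c pS(3)[of i] by (auto simp: I_def inner_commute)
      next
        case 2
        then show ?thesis using c pS(1)[of i] by (auto simp: inner_commute)
      qed
    next
      fix c assume "c \<in> I"
      then show "c \<in> active X p" using pS(3) J by (auto simp: I_def X_def active_def inner_commute)
    qed
    moreover have "dist x p \<le> 1"
    proof -
      have "\<bar>(x - p) \<bullet> i\<bar> \<le> \<delta>" if i: "i \<in> Basis" for i
      proof (cases "i \<in> J")
        case True
        then have "x \<bullet> i \<in> A i" using x J by blast
        then show ?thesis using True i by (auto simp: inner_diff_left p A_def)
      next
        case False
        then show ?thesis using i \<delta> by (simp add: inner_diff_left p)
      qed
      from norm_le_sum_coordinates[OF this] show ?thesis by (simp add: dist_norm \<delta>_def)
    qed
    ultimately show "x \<in> layer ?H X I 1"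
      using x by (simp add: layer_def AX[symmetric] cp)
  qed
  have "ennreal (\<delta> ^ card J * (\<Prod>i\<in>S - J. s i)) = emeasure ?M ?U"
  proof -
    have "emeasure ?M ?U = (\<Prod>i\<in>S. emeasure lborel (A i))"
      by (rule emeasure_coordinate_rectangle[OF S]) (auto simp: A_def)
    also have "\<dots> = (\<Prod>i\<in>J. emeasure lborel (A i)) * (\<Prod>i\<in>S - J. emeasure lborel (A i))"
      using J by (simp add: prod.subset_diff mult.commute)
    also have "(\<Prod>i\<in>J. emeasure lborel (A i)) = ennreal (\<delta> ^ card J)"
      using \<delta> by (simp add: A_def ennreal_power)
    also have "(\<Prod>i\<in>S - J. emeasure lborel (A i)) = (\<Prod>i\<in>S - J. ennreal (s i))"
      using s by (intro prod.cong) (auto simp: A_def less_imp_le)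
    also have "\<dots> = ennreal (\<Prod>i\<in>S - J. s i)"
      using s by (intro prod_ennreal) (auto simp: less_imp_le)
    finally show ?thesis using \<delta> by (simp add: ennreal_mult')
  qed
  also have "emeasure ?M ?U \<le> emeasure ?M (layer ?H X I 1)"
    using \<open>?U \<subseteq> _\<close> borel_layer[OF H X ne]
    by (intro emeasure_mono) (auto simp: subspace_lborel_def Let_def)
  also have "\<dots> = ennreal (measure ?M (layer ?H X I 1))"
    by (rule emeasure_eq_ennreal_measure) (rule emeasure_layer_finite[OF H X ne bd])
  finally have "\<delta> ^ card J * (\<Prod>i\<in>S - J. s i) \<le> measure ?M (layer ?H X I 1)"
    by simp
  also have "\<dots> \<le> (\<Sum>I | I \<subseteq> X \<and> dim ?H - dim (face_directions ?H I) = card J. measure ?M (layer ?H X I 1))"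
    using X IX codim by (intro member_le_sum) auto
  finally show ?thesis
    unfolding AX quermassintegral_polyhedron_in[OF H X ne bd jd] dim_coordinate_subspace[OF S] \<delta>_def
    by (rule divide_right_mono) simp
qed

section \<open>Thin boxes\<close>

lemma section_coordinate_box:
  assumes S: "S \<subseteq> Basis" and s: "\<And>i. i \<in> Basis \<Longrightarrow> 0 \<le> s i"
  shows "coordinate_box Basis s \<inter> coordinate_subspace S = coordinate_box S s"
proof -
  have "(\<forall>i\<in>Basis. 0 \<le> x \<bullet> i \<and> x \<bullet> i \<le> s i) \<longleftrightarrow> (\<forall>i\<in>S. 0 \<le> x \<bullet> i \<and> x \<bullet> i \<le> s i)"
    if x: "x \<in> coordinate_subspace S" for x
  proof -
    have "0 \<le> x \<bullet> i \<and> x \<bullet> i \<le> s i" if "i \<in> Basis" "i \<notin> S" for i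
      using x that s by (simp add: coordinate_subspace_def)
    then show ?thesis using S by blast
  qed
  then show ?thesis by (auto simp: coordinate_box_def coordinate_subspace_Basis)
qed

lemma projection_coordinate_box:
  assumes S: "S \<subseteq> Basis" and s: "\<And>i. i \<in> Basis \<Longrightarrow> 0 \<le> s i"
  shows "orth_proj (coordinate_subspace S) ` coordinate_box Basis s = coordinate_box S s"
proof (intro subset_antisym subsetI)
  fix y assume "y \<in> orth_proj (coordinate_subspace S) ` coordinate_box Basis s"
  then show "y \<in> coordinate_box S s"
    using orth_proj_mem[OF subspace_coordinate_subspace, of S] S
    by (auto simp: coordinate_box_def orth_proj_coordinate_subspace[OF S] subset_eq)
next
  fix y assume y: "y \<in> coordinate_box S s"
  then have "orth_proj (coordinate_subspace S) y = y"
    by (intro orth_proj_self subspace_coordinate_subspace) (simp add: coordinate_box_def)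
  moreover have "y \<in> coordinate_box Basis s"
    using y section_coordinate_box[OF S, of s] s by blast
  ultimately show "y \<in> orth_proj (coordinate_subspace S) ` coordinate_box Basis s"
    by (metis image_eqI)
qed

lemma coordinate_box_Basis_eq_cbox:
  "coordinate_box Basis s = cbox 0 (\<Sum>i\<in>Basis. s i *\<^sub>R i)"
  by (auto simp: coordinate_box_def coordinate_subspace_Basis mem_box)

text \<open>
  The operation $\mathit{cut}$ stands for section or projection; both agree on boxes and
  coordinate subspaces, and the other properties are what the upper bound needs.

  Let $K$ be the box with one side $\varepsilon$ and all others $1$. Choosing $J$ with $j$ elements
  to contain the thin direction, $W_j(K) \geq c$ with $c$ independent of $\varepsilon$; this is
  where $j \geq 1$ matters. The supremum over $H$ is at most a constant $V$, and it is positive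
  because of a coordinate subspace that contains the directions in $J$. So the quotient is at least
  $c / (\varepsilon^{k/n} V)$.
\<close>

lemma SUP_quermassintegral_ratio_eq_PInfty:
  fixes cut :: "'a::euclidean_space set \<Rightarrow> 'a set \<Rightarrow> 'a set" and j k :: nat
  assumes k: "0 < k" "k < DIM('a)" and j: "0 < j" "j \<le> DIM('a) - k"
    and polytope: "\<And>H K. subspace H \<Longrightarrow> polytope K \<Longrightarrow> polytope (cut H K)"
    and sub: "\<And>H K. subspace H \<Longrightarrow> cut H K \<subseteq> H"
    and zero: "\<And>H K. subspace H \<Longrightarrow> 0 \<in> K \<Longrightarrow> 0 \<in> cut H K"
    and bound: "\<And>H K r. subspace H \<Longrightarrow> K \<subseteq> cball 0 r \<Longrightarrow> cut H K \<subseteq> cball 0 r"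
    and box: "\<And>S s. S \<subseteq> Basis \<Longrightarrow> (\<And>i. i \<in> Basis \<Longrightarrow> 0 \<le> s i) \<Longrightarrow>
      cut (coordinate_subspace S) (coordinate_box Basis s) = coordinate_box S s"
  shows "(SUP K \<in> {K. convex_body K}.
            ereal (quermassintegral UNIV j K /
              (measure lborel K powr (real k / real (DIM('a))) *
               (SUP H \<in> grassmannian (DIM('a) - k). quermassintegral H j (cut H K))))) = \<infinity>"
proof (rule SUP_PInfty)
  fix N :: nat
  let ?n = "DIM('a)"
  obtain i0 :: 'a where i0: "i0 \<in> Basis" using nonempty_Basis by blast
  have "?n - k - 1 \<le> card (Basis - {i0})" using i0 by simp
  then obtain S' where S': "S' \<subseteq> Basis - {i0}" "card S' = ?n - k - 1"
    by (rule obtain_subset_with_card_n)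
  have "j - 1 \<le> card S'" using S'(2) j k by linarith
  then obtain J' where J': "J' \<subseteq> S'" "card J' = j - 1"
    by (rule obtain_subset_with_card_n)
  have "finite S'" using S'(1) finite_subset finite_Basis by blast
  define S where "S = insert i0 S'"
  define J where "J = insert i0 J'"
  have S: "S \<subseteq> Basis" and JS: "J \<subseteq> S" and i0J: "i0 \<in> J" using S' J' i0 by (auto simp: S_def J_def)
  have "i0 \<notin> S'" "i0 \<notin> J'" "finite J'" using S' J' finite_subset[OF J'(1) \<open>finite S'\<close>] by auto
  then have cS: "card S = ?n - k" and cJ: "card J = j"
    using S'(2) J'(2) \<open>finite S'\<close> k j by (simp_all add: S_def J_def)
  define c where "c = (1 / ?n) ^ j / real (?n choose j)"
  define V where "V = measure lborel (cball (0::'a) (real ?n + 1 + real ?n))"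
  have c: "0 < c" using j k by (simp add: c_def)
  have V: "0 < V" unfolding V_def by (intro content_cball_pos) auto
  \<comment> \<open>The value of $\varepsilon^{k/n}$ that makes the quotient at least $N$; it is capped at $1$ to keep the box in the unit cube.\<close>
  define y where "y = min 1 (c / (V * (real N + 1)))"
  have VN: "0 < V * (real N + 1)" using V by simp
  have y: "0 < y" "y \<le> 1" using c VN by (simp_all add: y_def)
  have "y \<le> c / (V * (real N + 1))" unfolding y_def by (rule min.cobounded2)
  then have yc: "y * (V * (real N + 1)) \<le> c" using VN by (simp add: pos_le_divide_eq)
  define \<epsilon> where "\<epsilon> = y powr (?n / k)"
  have \<epsilon>: "0 < \<epsilon>" "\<epsilon> \<le> 1" using y k by (auto simp: \<epsilon>_def powr_le1)
  have \<epsilon>k: "\<epsilon> powr (real k / ?n) = y" using y k by (simp add: \<epsilon>_def powr_powr)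
  define s where "s i = (if i = i0 then \<epsilon> else 1)" for i
  have s: "0 < s i" "s i \<le> 1" for i using \<epsilon> by (auto simp: s_def)
  have prod1: "(\<Prod>i\<in>T - J. s i) = 1" for T
    using i0J by (intro prod.neutral) (auto simp: s_def)
  define K where "K = coordinate_box Basis s"
  have K_cbox: "K = cbox 0 (\<Sum>i\<in>Basis. s i *\<^sub>R i)"
    unfolding K_def by (rule coordinate_box_Basis_eq_cbox)
  have "box 0 (\<Sum>i\<in>Basis. s i *\<^sub>R i) \<noteq> {}"
    using s by (simp add: box_ne_empty)
  then have K: "convex_body K"
    by (simp add: convex_body_def K_cbox compact_cbox convex_box interior_cbox)
  have polyK: "polytope K" unfolding K_cbox by (rule polytope_interval)
  have 0: "0 \<in> K" using s by (auto simp: K_def coordinate_box_def coordinate_subspace_def less_imp_le)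
  have "norm x \<le> real ?n * 1" if "x \<in> K" for x
  proof (rule norm_le_sum_coordinates)
    fix i :: 'a assume "i \<in> Basis"
    then have "0 \<le> x \<bullet> i" "x \<bullet> i \<le> s i" using that by (auto simp: K_def coordinate_box_def)
    then show "\<bar>x \<bullet> i\<bar> \<le> 1" using s(2)[of i] by linarith
  qed
  then have K_ball: "K \<subseteq> cball 0 ?n" by auto
  have volK: "measure lborel K = \<epsilon>"
  proof -
    have "measure lborel K = (\<Prod>i\<in>Basis. s i)"
      unfolding K_cbox using s by (subst content_cbox) (auto simp: less_imp_le)
    also have "\<dots> = \<epsilon>"
      unfolding s_def using i0 by simp
    finally show ?thesis .
  qed
  have WK: "c \<le> quermassintegral UNIV j K"
    using quermassintegral_coordinate_box_ge[of Basis J s] S JS s(1) cJ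
    by (simp add: K_def coordinate_subspace_Basis c_def prod1)
  let ?W = "\<lambda>H. quermassintegral H j (cut H K)"
  have le_V: "?W H \<le> V" if "H \<in> grassmannian (?n - k)" for H
    unfolding V_def using that zero[OF _ 0] j
    by (intro quermassintegral_polytope_le polytope polyK sub bound K_ball) (auto simp: grassmannian_def)
  have gr: "coordinate_subspace S \<in> grassmannian (?n - k)"
    using S cS by (simp add: grassmannian_def subspace_coordinate_subspace dim_coordinate_subspace)
  define D where "D = (SUP H \<in> grassmannian (?n - k). ?W H)"
  have "0 < (1 / ?n) ^ card J * (\<Prod>i\<in>S - J. s i) / (card S choose card J)"
    using j by (simp add: prod1 cS cJ)
  also have "\<dots> \<le> ?W (coordinate_subspace S)"
    using quermassintegral_coordinate_box_ge[OF S JS s(1)] s(1) S by (simp add: K_def box cJ less_imp_le)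
  also have "\<dots> \<le> D"
    unfolding D_def using le_V by (intro cSUP_upper gr bdd_aboveI2[of _ _ V])
  finally have D0: "0 < D" .
  have DV: "D \<le> V"
    unfolding D_def using gr le_V by (intro cSUP_least) auto
  have "real N \<le> quermassintegral UNIV j K / (measure lborel K powr (real k / ?n) * D)"
  proof -
    have "real N * (y * D) \<le> (real N + 1) * (y * V)"
      using DV D0 y by (intro mult_mono) auto
    also have "\<dots> \<le> c" using yc by (simp add: mult_ac)
    also note WK
    finally show ?thesis using y D0 by (simp add: volK \<epsilon>k pos_le_divide_eq)
  qed
  then show "\<exists>K\<in>{K :: 'a set. convex_body K}. ereal (real N) \<le> ereal (quermassintegral UNIV j K /
              (measure lborel K powr (real k / ?n) * (SUP H \<in> grassmannian (?n - k). quermassintegral H j (cut H K))))"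
    using K unfolding D_def by (intro bexI[of _ K]) auto
qed

theorem theorem1p2:
  fixes n k j :: nat
  assumes "CARD('n::finite) = n"
    and "n \<ge> 3"
    and "1 \<le> k" "k \<le> n - 2"
    and "1 \<le> j" "j \<le> n - k - 1"
  shows "(SUP K \<in> {K :: (real ^ 'n) set. convex_body K}.
            ereal (quermassintegral UNIV j K /
              (measure lborel K powr (real k / real n) *
               (SUP H \<in> grassmannian (n - k). quermassintegral H j (K \<inter> H))))) = \<infinity> \<and>
         (SUP K \<in> {K :: (real ^ 'n) set. convex_body K}.
            ereal (quermassintegral UNIV j K /
              (measure lborel K powr (real k / real n) *
               (SUP H \<in> grassmannian (n - k). quermassintegral H j (orth_proj H ` K))))) = \<infinity>"
proof
  have n: "DIM(real ^ 'n) = n" using assms(1) by simp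
  note * = SUP_quermassintegral_ratio_eq_PInfty[where 'a = "real ^ 'n" and j = j and k = k, unfolded n]
  have kj: "0 < k" "k < n" "0 < j" "j \<le> n - k" using assms by auto
  show "(SUP K \<in> {K :: (real ^ 'n) set. convex_body K}.
            ereal (quermassintegral UNIV j K /
              (measure lborel K powr (real k / real n) *
               (SUP H \<in> grassmannian (n - k). quermassintegral H j (K \<inter> H))))) = \<infinity>"
    by (rule *[where cut = "\<lambda>H K. K \<inter> H"])
       (use kj in \<open>auto simp: section_coordinate_box subspace_0
          intro!: polytope_Int_polyhedron affine_imp_polyhedron subspace_imp_affine\<close>)
  show "(SUP K \<in> {K :: (real ^ 'n) set. convex_body K}.
            ereal (quermassintegral UNIV j K /
              (measure lborel K powr (real k / real n) *
               (SUP H \<in> grassmannian (n - k). quermassintegral H j (orth_proj H ` K))))) = \<infinity>"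
  proof (rule *[where cut = "\<lambda>H K. orth_proj H ` K"])
    fix H K :: "(real ^ 'n) set" and r
    assume H: "subspace H"
    show "polytope (orth_proj H ` K)" if "polytope K"
      using linear_orth_proj[OF H] that by (rule polytope_linear_image)
    show "orth_proj H ` K \<subseteq> H" using orth_proj_mem[OF H] by blast
    show "0 \<in> orth_proj H ` K" if "0 \<in> K"
      using orth_proj_self[OF H subspace_0[OF H]] that by (metis image_eqI)
    show "orth_proj H ` K \<subseteq> cball 0 r" if "K \<subseteq> cball 0 r"
      using that norm_orth_proj_le[OF H] by (force intro: order_trans)
  qed (use kj in \<open>auto simp: projection_coordinate_box\<close>)
qed

end
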